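(* Baumslag's nonmetabelian group (the Baumslag–Gersten group) $G=\langle a,s\mid (sas^{-1})a(sa^{-1}s^{-1})=a^2\rangle$ is autostackable.
   Context: Let $G$ be a group with a finite inverse-closed generating set $X$, no element of which represents the identity. Let $\Gamma=\Gamma(G,X)$ be the Cayley graph, $\vec E$ its set of directed edges and $\vec P$ its set of directed edge paths. For $g\in G$, $a\in X$, $e_{g,a}$ is the directed edge from $g$ to $ga$ labeled $a$; $e_{g,a}$ and $e_{ga,a^{-1}}$ have the same underlying undirected edge. A flow function associated to a maximal tree $\mathcal T$ in $\Gamma$ is a function $\Phi:\vec E\to\vec P$ such that: (F1) $\Phi(e)$ has the same initial and terminal vertices as $e$; (F2d) if the undirected edge underlying $e$ lies in $\mathcal T$, then $\Phi(e)=e$; (F2r) the transitive closure of the relation $<$ on $\vec E$, where $e'<e$ whenever $e'$ lies on $\Phi(e)$ and the undirected edges underlying both $e$ and $e'$ do not lie in $\mathcal T$, is a well-founded strict partial ordering. It is bounded if there is a constant $k$ such that every path $\Phi(e)$ has length at most $k$. For $g\in G$, $\mathsf{nf}(g)\in X^*$ is the label of the unique path without backtracking in $\mathcal T$ from the identity to $g$, and $\mathcal N_{\mathcal T}=\{\mathsf{nf}(g)\mid g\in G\}$. The stacking map $\phi:\mathcal N_{\mathcal T}\times X\to X^*$ sends $(\mathsf{nf}(g),a)$ to the label of $\Phi(e_{g,a})$, and $\mathsf{graph}(\phi)=\{(\mathsf{nf}(g),a,\phi(\mathsf{nf}(g),a))\mid g\in G,a\in X\}\subseteq (X^* )^3$.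 A subset $L\subseteq (X^* )^n$ is synchronously regular if the set of padded words $\{\mathsf{pad}(w)\mid w\in L\}$ is a regular language over the alphabet $(X\cup\{\$\})^n$, where $\$\notin X$ and $\mathsf{pad}(w_1,\dots,w_n)$ is obtained by appending letters $\$$ to the ends of the shorter $w_i$ so that all have the same length $N=\max_i l(w_i)$, and reading the result as a word of length $N$ of $n$-tuples. $G$ is autostackable over $X$ if there is a bounded flow function on a maximal tree of $\Gamma(G,X)$ for which $\mathsf{graph}(\phi)$ is synchronously regular; $G$ is autostackable if this holds for some finite inverse-closed generating set. *)

theory Defs
  imports "HOL-Algebra.Generated_Groups" "Graph_Theory.Digraph_Component"
begin

section \<open>Cayley graphs and maximal trees\<close>

text \<open>
  The directed edge \<open>e\<^bsub>g,a\<^esub>\<close> is the pair \<open>(g, a)\<close>. The undirected graph is represented by the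
  digraph containing both orientations of every edge. When \<open>X\<close> is a set of group elements not
  containing the identity, there are no loops and no multiple edges.
\<close>

definition cayley_graph :: "('g, 'm) monoid_scheme \<Rightarrow> 'g set \<Rightarrow> ('g, 'g \<times> 'g) pre_digraph" where
  "cayley_graph G X =
     \<lparr>verts = carrier G, arcs = carrier G \<times> X, tail = fst, head = (\<lambda>(g, a). g \<otimes>\<^bsub>G\<^esub> a)\<rparr>"

definition reverse_edge :: "('g, 'm) monoid_scheme \<Rightarrow> 'g \<times> 'g \<Rightarrow> 'g \<times> 'g" where
  "reverse_edge G = (\<lambda>(g, a). (g \<otimes>\<^bsub>G\<^esub> a, inv\<^bsub>G\<^esub> a))"

text \<open>
  The library's \<^const>\<open>tree\<close> concerns directed cycles, hence treats an edge followed by its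
  reverse as a cycle. In a symmetric digraph without loops and multiple edges, the circuits of the
  underlying undirected graph are the directed cycles of length at least 3.
\<close>

definition undirected_tree :: "('v, 'e) pre_digraph \<Rightarrow> bool" where
  "undirected_tree H \<longleftrightarrow>
     symmetric H \<and> connected H \<and> \<not> (\<exists>p. pre_digraph.cycle H p \<and> 3 \<le> length p)"

definition maximal_tree :: "('v, 'e) pre_digraph \<Rightarrow> ('v, 'e) pre_digraph \<Rightarrow> bool" where
  "maximal_tree T \<Gamma> \<longleftrightarrow> pre_digraph.max_subgraph \<Gamma> undirected_tree T"


section \<open>Flow functions\<close>

text \<open>
  A directed edge path is the list of its edges. Its initial vertex, needed only for empty paths,
  is an argument of \<^const>\<open>pre_digraph.awalk\<close>. As \<open>T\<close> is symmetric, the undirected edge underlying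
  \<open>e\<close> lies in \<open>T\<close> iff \<open>e \<in> arcs T\<close>.
\<close>

definition flow_order ::
  "('v, 'e) pre_digraph \<Rightarrow> ('v, 'e) pre_digraph \<Rightarrow> ('e \<Rightarrow> 'e list) \<Rightarrow> ('e \<times> 'e) set" where
  "flow_order \<Gamma> T \<Phi> =
     {(e', e). e \<in> arcs \<Gamma> \<and> e' \<in> set (\<Phi> e) \<and> e \<notin> arcs T \<and> e' \<notin> arcs T}\<^sup>+"

definition flow_function ::
  "('v, 'e) pre_digraph \<Rightarrow> ('v, 'e) pre_digraph \<Rightarrow> ('e \<Rightarrow> 'e list) \<Rightarrow> bool" where
  "flow_function \<Gamma> T \<Phi> \<longleftrightarrow>
     (\<forall>e \<in> arcs \<Gamma>. pre_digraph.awalk \<Gamma> (tail \<Gamma> e) (\<Phi> e) (head \<Gamma> e)) \<and>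
     (\<forall>e \<in> arcs \<Gamma>. e \<in> arcs T \<longrightarrow> \<Phi> e = [e]) \<and>
     irrefl (flow_order \<Gamma> T \<Phi>) \<and> trans (flow_order \<Gamma> T \<Phi>) \<and> wf (flow_order \<Gamma> T \<Phi>)"

definition bounded_flow :: "('v, 'e) pre_digraph \<Rightarrow> ('e \<Rightarrow> 'e list) \<Rightarrow> bool" where
  "bounded_flow \<Gamma> \<Phi> \<longleftrightarrow> (\<exists>k. \<forall>e \<in> arcs \<Gamma>. length (\<Phi> e) \<le> k)"


section \<open>Normal forms and the stacking map\<close>

definition path_label :: "('g \<times> 'g) list \<Rightarrow> 'g list" where
  "path_label p = map snd p"

definition non_backtracking :: "('g, 'm) monoid_scheme \<Rightarrow> ('g \<times> 'g) list \<Rightarrow> bool" where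
  "non_backtracking G p \<longleftrightarrow> (\<forall>i. Suc i < length p \<longrightarrow> p ! Suc i \<noteq> reverse_edge G (p ! i))"

definition normal_form ::
  "('g, 'm) monoid_scheme \<Rightarrow> ('g, 'g \<times> 'g) pre_digraph \<Rightarrow> 'g \<Rightarrow> 'g list" where
  "normal_form G T g =
     path_label (THE p. pre_digraph.awalk T \<one>\<^bsub>G\<^esub> p g \<and> non_backtracking G p)"

definition stacking_map ::
  "('g, 'm) monoid_scheme \<Rightarrow> ('g, 'g \<times> 'g) pre_digraph \<Rightarrow> ('g \<times> 'g \<Rightarrow> ('g \<times> 'g) list)
    \<Rightarrow> 'g list \<Rightarrow> 'g \<Rightarrow> 'g list" where
  "stacking_map G T \<Phi> w a =
     path_label (\<Phi> (the_inv_into (carrier G) (normal_form G T) w, a))"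

text \<open>The elements of \<open>(X\<^sup>*)\<^sup>n\<close> are represented by lists of length \<open>n\<close>.\<close>

definition stacking_graph ::
  "('g, 'm) monoid_scheme \<Rightarrow> 'g set \<Rightarrow> ('g, 'g \<times> 'g) pre_digraph
    \<Rightarrow> ('g \<times> 'g \<Rightarrow> ('g \<times> 'g) list) \<Rightarrow> 'g list list set" where
  "stacking_graph G X T \<Phi> =
     {[normal_form G T g, [a], stacking_map G T \<Phi> (normal_form G T g) a] | g a.
        g \<in> carrier G \<and> a \<in> X}"


section \<open>Synchronous regularity\<close>

text \<open>Acceptance by a deterministic finite automaton; its states may be taken to be numbers.\<close>

definition regular_language :: "'c set \<Rightarrow> 'c list set \<Rightarrow> bool" where
  "regular_language A L \<longleftrightarrow>
     (\<exists>(Q :: nat set) q0 F \<delta>.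
        finite Q \<and> q0 \<in> Q \<and> F \<subseteq> Q \<and> (\<forall>q \<in> Q. \<forall>c \<in> A. \<delta> q c \<in> Q) \<and>
        L = {w \<in> lists A. foldl \<delta> q0 w \<in> F})"

text \<open>The padding letter is \<^const>\<open>None\<close>.\<close>

definition pad :: "'c list list \<Rightarrow> 'c option list list" where
  "pad ws =
     map (\<lambda>i. map (\<lambda>w. if i < length w then Some (w ! i) else None) ws)
       [0..<Max (length ` set ws)]"

definition padded_alphabet :: "nat \<Rightarrow> 'c set \<Rightarrow> 'c option list set" where
  "padded_alphabet n X = {t. length t = n \<and> set t \<subseteq> insert None (Some ` X)}"

definition synchronously_regular :: "nat \<Rightarrow> 'c set \<Rightarrow> 'c list list set \<Rightarrow> bool" where
  "synchronously_regular n X L \<longleftrightarrow>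
     L \<subseteq> {ws. length ws = n \<and> set ws \<subseteq> lists X} \<and>
     regular_language (padded_alphabet n X) (pad ` L)"


section \<open>Autostackable groups\<close>

definition autostackable_over :: "('g, 'm) monoid_scheme \<Rightarrow> 'g set \<Rightarrow> bool" where
  "autostackable_over G X \<longleftrightarrow>
     (\<exists>T \<Phi>. maximal_tree T (cayley_graph G X) \<and>
        flow_function (cayley_graph G X) T \<Phi> \<and>
        bounded_flow (cayley_graph G X) \<Phi> \<and>
        synchronously_regular 3 X (stacking_graph G X T \<Phi>))"

definition autostackable :: "('g, 'm) monoid_scheme \<Rightarrow> bool" where
  "autostackable G \<longleftrightarrow>
     group G \<and>
     (\<exists>X. finite X \<and> X \<subseteq> carrier G \<and> \<one>\<^bsub>G\<^esub> \<notin> X \<and> (\<forall>a \<in> X. inv\<^bsub>G\<^esub> a \<in> X) \<and>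
        generate G X = carrier G \<and> autostackable_over G X)"


section \<open>Group presentations\<close>

text \<open>
  The letters \<open>(x, True)\<close> and \<open>(x, False)\<close> stand for the generator \<open>x\<close> and its inverse. A relation
  \<open>l = r\<close> is the pair \<open>(l, r)\<close> of words. All elements of the type \<open>'x\<close> are generators.
\<close>

inductive_set presentation_congruence ::
  "(('x \<times> bool) list \<times> ('x \<times> bool) list) set
    \<Rightarrow> (('x \<times> bool) list \<times> ('x \<times> bool) list) set"
  for R where
  cong_refl: "(u, u) \<in> presentation_congruence R"
| cong_sym: "(u, v) \<in> presentation_congruence R \<Longrightarrow> (v, u) \<in> presentation_congruence R"
| cong_trans: "(u, v) \<in> presentation_congruence R \<Longrightarrow> (v, w) \<in> presentation_congruence R
    \<Longrightarrow> (u, w) \<in> presentation_congruence R"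
| cong_cancel: "(u @ [(x, b), (x, \<not> b)] @ v, u @ v) \<in> presentation_congruence R"
| cong_relation: "(l, r) \<in> R \<Longrightarrow> (u @ l @ v, u @ r @ v) \<in> presentation_congruence R"

definition presented_group ::
  "(('x \<times> bool) list \<times> ('x \<times> bool) list) set \<Rightarrow> ('x \<times> bool) list set monoid" where
  "presented_group R =
     \<lparr>carrier = UNIV // presentation_congruence R,
      monoid.mult = (\<lambda>A B. \<Union>u\<in>A. \<Union>v\<in>B. presentation_congruence R `` {u @ v}),
      one = presentation_congruence R `` {[]}\<rparr>"

lemma equiv_presentation_congruence: "equiv UNIV (presentation_congruence R)"
proof (rule equivI)
  show "refl_on UNIV (presentation_congruence R)"
    by (rule refl_onI) (rule cong_refl)
  show "sym (presentation_congruence R)"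
    by (rule symI) (rule cong_sym)
  show "trans (presentation_congruence R)"
    by (rule transI) (rule cong_trans)
qed simp

lemma presentation_congruence_context:
  "(u, v) \<in> presentation_congruence R \<Longrightarrow> (p @ u @ q, p @ v @ q) \<in> presentation_congruence R"
proof (induction rule: presentation_congruence.induct)
  case (cong_refl u)
  show ?case by (rule presentation_congruence.cong_refl)
next
  case (cong_sym u v)
  show ?case by (rule presentation_congruence.cong_sym) (rule cong_sym.IH)
next
  case (cong_trans u v w)
  show ?case by (rule presentation_congruence.cong_trans) (rule cong_trans.IH)+
next
  case (cong_cancel u x b v)
  show ?case using presentation_congruence.cong_cancel[of "p @ u" x b "v @ q" R] by simp
next
  case (cong_relation l r u v)
  then show ?case using presentation_congruence.cong_relation[of l r R "p @ u" "v @ q"] by simp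
qed

lemma presentation_congruence_append:
  assumes "(u, u') \<in> presentation_congruence R" "(v, v') \<in> presentation_congruence R"
  shows "(u @ v, u' @ v') \<in> presentation_congruence R"
proof (rule cong_trans)
  show "(u @ v, u' @ v) \<in> presentation_congruence R"
    using presentation_congruence_context[OF assms(1), of "[]" v] by simp
  show "(u' @ v, u' @ v') \<in> presentation_congruence R"
    using presentation_congruence_context[OF assms(2), of u' "[]"] by simp
qed

lemma presented_group_mult:
  "presentation_congruence R `` {u} \<otimes>\<^bsub>presented_group R\<^esub> presentation_congruence R `` {v}
     = presentation_congruence R `` {u @ v}"
proof -
  have "congruent2 (presentation_congruence R) (presentation_congruence R)
      (\<lambda>u v. presentation_congruence R `` {u @ v})"
    by (rule congruent2I')
      (rule equiv_class_eq[OF equiv_presentation_congruence presentation_congruence_append])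
  then have "(\<Union>u'\<in>presentation_congruence R `` {u}. \<Union>v'\<in>presentation_congruence R `` {v}.
      presentation_congruence R `` {u' @ v'}) = presentation_congruence R `` {u @ v}"
    by (rule UN_equiv_class2[OF equiv_presentation_congruence equiv_presentation_congruence])
      (rule UNIV_I)+
  then show ?thesis
    by (simp only: presented_group_def monoid.simps)
qed

lemma presentation_congruence_inverse:
  "(map (\<lambda>(x, b). (x, \<not> b)) (rev w) @ w, []) \<in> presentation_congruence R"
proof (induction w)
  case Nil
  show ?case by (simp add: cong_refl)
next
  case (Cons c w)
  obtain x b where c: "c = (x, b)" by (cases c)
  have "(map (\<lambda>(x, b). (x, \<not> b)) (rev (c # w)) @ c # w,
         map (\<lambda>(x, b). (x, \<not> b)) (rev w) @ w) \<in> presentation_congruence R"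
    using cong_cancel[of "map (\<lambda>(x, b). (x, \<not> b)) (rev w)" x "\<not> b" w R] by (simp add: c)
  then show ?case using Cons.IH by (rule cong_trans)
qed

lemma group_presented_group: "group (presented_group R)"
proof (rule groupI)
  let ?C = "\<lambda>w. presentation_congruence R `` {w}"
  have carrier: "carrier (presented_group R) = range ?C"
    unfolding presented_group_def quotient_def by auto
  have one: "\<one>\<^bsub>presented_group R\<^esub> = ?C []"
    by (simp add: presented_group_def)
  show "\<one>\<^bsub>presented_group R\<^esub> \<in> carrier (presented_group R)"
    by (simp add: carrier one)
  fix A assume "A \<in> carrier (presented_group R)"
  then obtain u where A: "A = ?C u" by (auto simp: carrier)
  show "\<one>\<^bsub>presented_group R\<^esub> \<otimes>\<^bsub>presented_group R\<^esub> A = A"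
    by (simp add: A one presented_group_mult)
  have "?C (map (\<lambda>(x, b). (x, \<not> b)) (rev u) @ u) = ?C []"
    by (rule equiv_class_eq[OF equiv_presentation_congruence presentation_congruence_inverse])
  then show "\<exists>B\<in>carrier (presented_group R). B \<otimes>\<^bsub>presented_group R\<^esub> A = \<one>\<^bsub>presented_group R\<^esub>"
    by (auto simp: A one carrier presented_group_mult)
  fix B assume "B \<in> carrier (presented_group R)"
  then obtain v where B: "B = ?C v" by (auto simp: carrier)
  show "A \<otimes>\<^bsub>presented_group R\<^esub> B \<in> carrier (presented_group R)"
    by (simp add: A B carrier presented_group_mult)
  fix C assume "C \<in> carrier (presented_group R)"
  then obtain w where C: "C = ?C w" by (auto simp: carrier)
  show "A \<otimes>\<^bsub>presented_group R\<^esub> B \<otimes>\<^bsub>presented_group R\<^esub> C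
      = A \<otimes>\<^bsub>presented_group R\<^esub> (B \<otimes>\<^bsub>presented_group R\<^esub> C)"
    by (simp add: A B C presented_group_mult)
qed


section \<open>The Baumslag--Gersten group\<close>

datatype baumslag_generator = Gen_a | Gen_s

definition baumslag_relations ::
  "((baumslag_generator \<times> bool) list \<times> (baumslag_generator \<times> bool) list) set" where
  "baumslag_relations =
     (let a = (Gen_a, True); a' = (Gen_a, False); s = (Gen_s, True); s' = (Gen_s, False)
      in {([s, a, s'] @ [a] @ [s, a', s'], [a, a])})"

definition baumslag_gersten_group :: "(baumslag_generator \<times> bool) list set monoid" where
  "baumslag_gersten_group = presented_group baumslag_relations"

end

theory Submission
  imports Defs "HOL-Computational_Algebra.Primes"
begin

text \<open>
  Put \<open>t = s a s\<^sup>-\<^sup>1\<close>. Then \<open>G = \<langle>a, t, s | t a = a\<^sup>2 t, s a = t s\<rangle>\<close> is an HNN extension of the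
  Baumslag--Solitar group \<open>H = \<langle>a, t\<rangle>\<close>, itself an HNN extension of \<open>\<langle>a\<rangle>\<close>. Britton normal forms over
  \<open>{a, t, s}\<^sup>\<plusminus>\<^sup>1\<close> are prefix-closed, hence span a maximal tree, if the coset representatives are chosen
  as normal forms of \<open>H\<close>: those ending with \<open>t\<^sup>\<plusminus>\<^sup>1\<close> (and \<open>1\<close>) for \<open>H / \<langle>a\<rangle>\<close>, and \<open>1\<close> and all \<open>t\<^sup>n a\<^sup>k\<close>
  with \<open>k\<close> odd for \<open>H / \<langle>t\<rangle>\<close>. With this choice a finite automaton reading the normal form of \<open>h \<in> H\<close> can
  tell the signs of \<open>k\<close> and \<open>j\<close> in the decompositions \<open>h = r a\<^sup>k = r' t\<^sup>j\<close>.

  An edge outside the tree is replaced by the other side of a defining relation, chosen according to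
  these signs: \<open>t\<close> by \<open>a\<^sup>-\<^sup>2 t a\<close> or \<open>a\<^sup>2 t a\<^sup>-\<^sup>1\<close>, \<open>s\<close> by \<open>t\<^sup>-\<^sup>1 s a\<close> or \<open>t s a\<^sup>-\<^sup>1\<close>, and similarly for \<open>t\<^sup>-\<^sup>1\<close>
  and \<open>s\<^sup>-\<^sup>1\<close>. This lowers \<open>\<bar>k\<bar>\<close> or \<open>\<bar>j\<bar>\<close>, and edges with label \<open>a\<^sup>\<plusminus>\<^sup>1\<close> all lie in the tree; so the flow
  is well-founded once \<open>s\<close>-edges are placed above \<open>t\<close>-edges.
\<close>

section \<open>Regular languages\<close>

text \<open>An injection codes the finite state set by numbers, and runs are transported along it.
  Since runs from \<open>init\<close> stay in \<open>Q\<close>, cutting \<open>F\<close> down to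
  \<open>F \<inter> Q\<close> does not change acceptance.\<close>

lemma regular_languageI:
  fixes \<delta> :: "'s \<Rightarrow> 'c \<Rightarrow> 's"
  assumes fin: "finite Q" and init: "init \<in> Q"
    and step: "\<And>q c. q \<in> Q \<Longrightarrow> c \<in> A \<Longrightarrow> \<delta> q c \<in> Q"
    and L: "L = {w \<in> lists A. foldl \<delta> init w \<in> F}"
  shows "regular_language A L"
proof -
  obtain f :: "'s \<Rightarrow> nat" where f: "inj_on f Q"
    using finite_imp_inj_to_nat_seg[OF fin] by blast
  define g where "g = the_inv_into Q f"
  have g: "g (f q) = q" if "q \<in> Q" for q
    using that f by (simp add: g_def the_inv_into_f_f)
  define \<delta>' where "\<delta>' n c = f (\<delta> (g n) c)" for n c
  have run: "foldl \<delta>' (f q) w = f (foldl \<delta> q w) \<and> foldl \<delta> q w \<in> Q"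
    if "q \<in> Q" "w \<in> lists A" for q w
    using that by (induction w arbitrary: q) (auto simp: \<delta>'_def g step)
  show ?thesis
    unfolding regular_language_def
  proof (intro exI conjI ballI)
    show "finite (f ` Q)" using fin by simp
    show "f init \<in> f ` Q" using init by simp
    show "f ` (F \<inter> Q) \<subseteq> f ` Q" by auto
    show "\<delta>' n c \<in> f ` Q" if "n \<in> f ` Q" "c \<in> A" for n c
      using that by (auto simp: \<delta>'_def g step)
    show "L = {w \<in> lists A. foldl \<delta>' (f init) w \<in> f ` (F \<inter> Q)}"
      proof (intro Set.set_eqI)
      fix w
      show "w \<in> L \<longleftrightarrow> w \<in> {w \<in> lists A. foldl \<delta>' (f init) w \<in> f ` (F \<inter> Q)}"
      proof (cases "w \<in> lists A")
        case True
        then show ?thesis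
          using run[OF init True] inj_on_image_mem_iff[OF f, of "foldl \<delta> init w" "F \<inter> Q"] by (auto simp: L)
      qed (simp add: L)
    qed
  qed
qed

lemma regular_language_empty: "regular_language A {}"
  by (rule regular_languageI[where Q = "{()}" and init = "()" and F = "{}"]) auto

lemma regular_language_Un:
  assumes "regular_language A L" "regular_language A M"
  shows "regular_language A (L \<union> M)"
proof -
  from assms(1) obtain Q1 :: "nat set" and q1 F1 \<delta>1 where 1: "finite Q1" "q1 \<in> Q1"
      "\<forall>q\<in>Q1. \<forall>c\<in>A. \<delta>1 q c \<in> Q1" "L = {w \<in> lists A. foldl \<delta>1 q1 w \<in> F1}"
    unfolding regular_language_def by blast
  from assms(2) obtain Q2 :: "nat set" and q2 F2 \<delta>2 where 2: "finite Q2" "q2 \<in> Q2"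
      "\<forall>q\<in>Q2. \<forall>c\<in>A. \<delta>2 q c \<in> Q2" "M = {w \<in> lists A. foldl \<delta>2 q2 w \<in> F2}"
    unfolding regular_language_def by blast
  let ?\<delta> = "\<lambda>(p, q) c. (\<delta>1 p c, \<delta>2 q c)"
  have run: "foldl ?\<delta> (p, q) w = (foldl \<delta>1 p w, foldl \<delta>2 q w)" for p q w
    by (induction w arbitrary: p q) auto
  show ?thesis
    by (rule regular_languageI[where Q = "Q1 \<times> Q2" and init = "(q1, q2)" and \<delta> = ?\<delta>
          and F = "{(p, q). p \<in> F1 \<or> q \<in> F2}"]) (use 1 2 in \<open>auto simp: run\<close>)
qed

lemma regular_language_UN:
  "finite I \<Longrightarrow> (\<And>i. i \<in> I \<Longrightarrow> regular_language A (L i)) \<Longrightarrow> regular_language A (\<Union>i\<in>I. L i)"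
  by (induction I rule: finite_induct) (auto intro: regular_language_empty regular_language_Un)

text \<open>
  Once the padded word is longer than the last two components, only the first component matters;
  so a counter up to that length, together with a state for the first component, suffices.
\<close>

lemma regular_language_pad:
  assumes L: "regular_language X L" and LX: "L \<subseteq> lists X" and u: "u \<in> lists X" and v: "v \<in> lists X"
  shows "regular_language (padded_alphabet 3 X) (pad ` {[w, u, v] | w. w \<in> L})"
proof -
  define A where "A = padded_alphabet 3 X"
  from L obtain Q :: "nat set" and q0 F \<delta> where aut: "finite Q" "q0 \<in> Q"
      "\<forall>q\<in>Q. \<forall>c\<in>X. \<delta> q c \<in> Q" "L = {w \<in> lists X. foldl \<delta> q0 w \<in> F}"
    unfolding regular_language_def by blast
  define K where "K = max (length u) (length v)"
  define letter where "letter w i = (if i < length w then Some (w ! i) else None)" for w :: "'a list" and i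
  define enc where "enc w N = map (\<lambda>i. [letter w i, letter u i, letter v i]) [0..<N]" for w N
  have pad: "pad [w, u, v] = enc w (max (length w) K)" for w
    by (simp add: pad_def enc_def letter_def K_def)
  \<comment> \<open>From position \<open>K\<close> on, both fixed words contribute only padding, so
    a counter capped at \<open>K\<close> still determines the letters expected from them.\<close>
  have letter_min: "letter u (min n K) = letter u n" "letter v (min n K) = letter v n" for n
    by (auto simp: letter_def K_def min_def)
  have letter_X: "letter w i \<in> insert None (Some ` X)" if "w \<in> lists X" for w i
    using that by (auto simp: letter_def in_lists_conv_set)
  have enc_lists: "enc w N \<in> lists A" if "w \<in> lists X" for w N
    unfolding A_def in_lists_conv_set
  proof
    fix c assume "c \<in> set (enc w N)"
    then obtain i where "c = [letter w i, letter u i, letter v i]" by (auto simp: enc_def)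
    then show "c \<in> padded_alphabet 3 X"
      unfolding padded_alphabet_def using letter_X[OF that, of i] letter_X[OF u, of i] letter_X[OF v, of i] by simp
  qed
  have letter_append: "letter (w @ [x]) i = letter w i" if "i < length w" for w x i
    using that by (simp add: letter_def nth_append)
  have enc_snoc: "enc w (Suc N) = enc w N @ [[letter w N, letter u N, letter v N]]" for w N
    by (simp add: enc_def)
  have enc_extend: "enc (w @ [x]) (length w) = enc w (length w)" for w x
    by (simp add: enc_def letter_append)
  define st where "st = (\<lambda>s c. case s of None \<Rightarrow> None | Some (n, full, q) \<Rightarrow>
     if tl c \<noteq> [letter u n, letter v n] then None
     else case hd c of
         None \<Rightarrow> if n < K then Some (Suc n, False, q) else None
       | Some x \<Rightarrow> if full \<and> x \<in> X then Some (min (Suc n) K, True, \<delta> q x) else None)"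
  \<comment> \<open>The clause \<open>full \<or> length W \<le> K\<close> says that \<open>W\<close>
    has not outrun the longest of the three words.\<close>
  have run: "foldl st (Some (0, True, q0)) W = Some (n, full, q) \<longleftrightarrow>
      (\<exists>w\<in>lists X. length w \<le> length W \<and> W = enc w (length W) \<and> n = min (length W) K \<and>
        full = (length w = length W) \<and> q = foldl \<delta> q0 w \<and> (full \<or> length W \<le> K))"
    if "W \<in> lists A" for W n full q
    using that
  proof (induction W arbitrary: n full q rule: rev_induct)
    case Nil
    show ?case by (auto simp: enc_def)
  next
    case (snoc c W)
    from snoc.prems have W: "W \<in> lists A" and "length c = 3" by (auto simp: A_def padded_alphabet_def)
    then obtain c1 c2 c3 where c: "c = [c1, c2, c3]"
      by (auto simp: length_Suc_conv eval_nat_numeral)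
    note IH = snoc.IH[OF W]
    show ?case (is "?l = ?r")
    proof
      assume ?l
      then obtain n' full' q' where s: "foldl st (Some (0, True, q0)) W = Some (n', full', q')"
        and s': "st (Some (n', full', q')) c = Some (n, full, q)"
        by (cases "foldl st (Some (0, True, q0)) W") (auto simp: st_def)
      from s IH obtain w where w: "w \<in> lists X" "length w \<le> length W" "W = enc w (length W)"
          "n' = min (length W) K" "full' = (length w = length W)" "q' = foldl \<delta> q0 w"
          "full' \<or> length W \<le> K" by metis
      from s' have c23: "c2 = letter u (length W)" "c3 = letter v (length W)"
        by (auto simp: st_def c w(4) letter_min split: if_splits)
      show ?r
      proof (cases c1)
        case None
        with s' have "n' < K" "n = Suc n'" "\<not> full" "q = q'"
          by (auto simp: st_def c split: if_splits)
        moreover have "letter w (length W) = None" using w by (simp add: letter_def)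
        ultimately show ?thesis using w c23 None c
          by (intro bexI[of _ w]) (auto simp: enc_snoc)
      next
        case (Some x)
        with s' have x: "full'" "x \<in> X" "n = min (Suc n') K" "full" "q = \<delta> q' x"
          by (auto simp: st_def c split: if_splits)
        with w have len: "length w = length W" by simp
        have "enc (w @ [x]) (length W) = W" "letter (w @ [x]) (length W) = Some x"
          using w(3) len enc_extend[of w x] by (simp_all add: letter_def nth_append)
        then have "enc (w @ [x]) (length (W @ [c])) = W @ [c]"
          using c23 Some by (simp add: enc_snoc c)
        then show ?thesis using w x len
          by (intro bexI[of _ "w @ [x]"]) auto
      qed
    next
      assume ?r
      then obtain w where w: "w \<in> lists X" "length w \<le> Suc (length W)"
          "W @ [c] = enc w (Suc (length W))" "n = min (Suc (length W)) K"
          "full = (length w = Suc (length W))" "q = foldl \<delta> q0 w" "full \<or> Suc (length W) \<le> K"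
        by auto
      from w(3) have W': "W = enc w (length W)"
        and c': "c = [letter w (length W), letter u (length W), letter v (length W)]"
        by (simp_all add: enc_snoc)
      show ?l
      proof (cases full)
        case True
        with w(5) obtain w' x where w': "w = w' @ [x]" "length w' = length W"
          by (cases w rule: rev_cases) auto
        have "foldl st (Some (0, True, q0)) W = Some (min (length W) K, True, foldl \<delta> q0 w')"
          unfolding IH using w' W' w enc_extend[of w' x] by (intro bexI[of _ w']) auto
        moreover have "letter w (length W) = Some x" using w' by (simp add: letter_def nth_append)
        moreover have "x \<in> X" using w(1) w' by simp
        ultimately show ?thesis using w'(1) w(4,6) True
          by (simp add: st_def c' letter_min)
      next
        case False
        with w have len: "length w \<le> length W" and K: "Suc (length W) \<le> K" by auto
        have "foldl st (Some (0, True, q0)) W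
            = Some (min (length W) K, length w = length W, foldl \<delta> q0 w)"
          unfolding IH using W' w K len by (intro bexI[of _ w]) auto
        moreover have "letter w (length W) = None" using len by (simp add: letter_def)
        ultimately show ?thesis using w(4,6) K False
          by (simp add: st_def c' letter_min)
      qed
    qed
  qed
  define S where "S = insert None (Some ` ({0..K} \<times> (UNIV :: bool set) \<times> Q))"
  have "regular_language A (pad ` {[w, u, v] | w. w \<in> L})"
  \<comment> \<open>A counter equal to \<open>K\<close> says that \<open>u\<close> and
    \<open>v\<close> have been read to the end. The first word may end with the input or before it,
    hence \<open>b\<close> is free.\<close>
  proof (rule regular_languageI[where Q = S and \<delta> = st and init = "Some (0, True, q0)"
        and F = "{Some (K, b, q) | (b :: bool) q. q \<in> F}"])
    show "finite S" using aut(1) by (simp add: S_def)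
    show "Some (0, True, q0) \<in> S" using aut(2) by (simp add: S_def)
    show "st s c \<in> S" if "s \<in> S" "c \<in> A" for s c
      using that aut(3) by (auto simp: S_def st_def split: option.splits)
    show "pad ` {[w, u, v] |w. w \<in> L} =
        {W \<in> lists A. foldl st (Some (0, True, q0)) W \<in> {Some (K, b, q) | (b :: bool) q. q \<in> F}}"
      (is "?l = ?r")
    proof (rule Set.set_eqI)
      fix W
      show "W \<in> ?l \<longleftrightarrow> W \<in> ?r"
      proof
        assume "W \<in> ?l"
        then obtain w where w: "w \<in> L" and W: "W = enc w (max (length w) K)" by (auto simp: pad)
        with LX have wX: "w \<in> lists X" by auto
        have len: "length W = max (length w) K" by (simp add: W enc_def)
        have "foldl st (Some (0, True, q0)) W = Some (K, length w = length W, foldl \<delta> q0 w)"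
          unfolding run[OF enc_lists[OF wX, of "max (length w) K", folded W]]
          using wX W len by (intro bexI[of _ w]) auto
        with w aut(4) show "W \<in> ?r" using enc_lists[OF wX, of "max (length w) K", folded W] by auto
      next
        assume "W \<in> ?r"
        then obtain b q where W: "W \<in> lists A" and q: "q \<in> F"
          and s: "foldl st (Some (0, True, q0)) W = Some (K, b, q)" by auto
        from s run[OF W] obtain w where w: "w \<in> lists X" "length w \<le> length W"
            "W = enc w (length W)" "K = min (length W) K" "b = (length w = length W)"
            "q = foldl \<delta> q0 w" "b \<or> length W \<le> K" by metis
        then have "length W = max (length w) K" by auto
        with w q aut(4) show "W \<in> ?l" by (auto simp: pad intro!: image_eqI[of _ _ "[w, u, v]"])
      qed
    qed
  qed
  then show ?thesis by (simp add: A_def)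
qed


section \<open>Prefix-closed normal forms\<close>

primrec edge_path :: "('g, 'm) monoid_scheme \<Rightarrow> 'g \<Rightarrow> 'g list \<Rightarrow> ('g \<times> 'g) list" where
  "edge_path G g [] = []"
| "edge_path G g (x # w) = (g, x) # edge_path G (g \<otimes>\<^bsub>G\<^esub> x) w"

lemma path_label_edge_path [simp]: "path_label (edge_path G g w) = w"
  by (induction w arbitrary: g) (auto simp: path_label_def)

lemma length_edge_path [simp]: "length (edge_path G g w) = length w"
  by (induction w arbitrary: g) auto

locale prefix_closed_normal_forms = group G for G (structure) +
  fixes X :: "'a set" and nf :: "'a \<Rightarrow> 'a list"
  assumes X_carrier: "X \<subseteq> carrier G"
    and one_notin_X: "\<one> \<notin> X"
    and inv_X: "x \<in> X \<Longrightarrow> inv x \<in> X"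
    and nf_lists: "g \<in> carrier G \<Longrightarrow> nf g \<in> lists X"
    and nf_Nil_iff: "g \<in> carrier G \<Longrightarrow> nf g = [] \<longleftrightarrow> g = \<one>"
    and nf_prefix: "\<lbrakk>g \<in> carrier G; nf g = w @ [x]\<rbrakk> \<Longrightarrow> nf (g \<otimes> inv x) = w"
begin

lemma X_closed [simp]: "x \<in> X \<Longrightarrow> x \<in> carrier G"
  using X_carrier by blast

lemma nf_snocE:
  assumes "g \<in> carrier G" "nf g = w @ [x]"
  obtains h where "h \<in> carrier G" "x \<in> X" "g = h \<otimes> x" "nf h = w"
proof
  show x: "x \<in> X" using nf_lists[OF assms(1)] assms(2) by simp
  show "g \<otimes> inv x \<in> carrier G" "g = g \<otimes> inv x \<otimes> x" "nf (g \<otimes> inv x) = w"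
    using assms x nf_prefix by (simp_all add: m_assoc)
qed

lemma nf_induct [consumes 1, case_names one ext]:
  assumes "g \<in> carrier G"
    and "P \<one>"
    and ext: "\<And>g x. \<lbrakk>g \<in> carrier G; x \<in> X; nf (g \<otimes> x) = nf g @ [x]; P g\<rbrakk> \<Longrightarrow> P (g \<otimes> x)"
  shows "P g"
  using assms(1)
proof (induction "nf g" arbitrary: g rule: rev_induct)
  case Nil
  then have "g = \<one>" using nf_Nil_iff[of g] by simp
  then show ?case using assms(2) by simp
next
  case (snoc x w)
  then obtain h where "h \<in> carrier G" "x \<in> X" "g = h \<otimes> x" "nf h = w"
    by (metis nf_snocE)
  then show ?case using snoc ext by metis
qed

lemma inj_on_nf: "inj_on nf (carrier G)"
proof (rule inj_onI)
  fix g h assume "g \<in> carrier G" "h \<in> carrier G" "nf g = nf h"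
  then show "g = h"
  proof (induction "nf g" arbitrary: g h rule: rev_induct)
    case Nil
    then show ?case using nf_Nil_iff by metis
  next
    case (snoc x w)
    then obtain g' h' where "g' \<in> carrier G" "g = g' \<otimes> x" "nf g' = w"
      "h' \<in> carrier G" "h = h' \<otimes> x" "nf h' = w"
      by (metis nf_snocE)
    with snoc(1) show ?case by metis
  qed
qed

lemma generate_X: "generate G X = carrier G"
proof
  show "generate G X \<subseteq> carrier G"
    using X_carrier by (rule generate_incl)
  show "carrier G \<subseteq> generate G X"
  proof
    fix g assume "g \<in> carrier G"
    then show "g \<in> generate G X"
      by (induction rule: nf_induct) (auto intro: generate.intros)
  qed
qed

text \<open>The parent of an element arises by deleting the last letter of its normal form. The two
  alternatives are a step to a child and a step to the parent.\<close>

definition tree_edge :: "'a \<Rightarrow> 'a \<Rightarrow> bool" where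
  "tree_edge g x \<longleftrightarrow> nf (g \<otimes> x) = nf g @ [x] \<or> nf g = nf (g \<otimes> x) @ [inv x]"

abbreviation \<Gamma> :: "('a, 'a \<times> 'a) pre_digraph" where
  "\<Gamma> \<equiv> cayley_graph G X"

definition T :: "('a, 'a \<times> 'a) pre_digraph" where
  "T = \<lparr>verts = carrier G, arcs = {(g, x). g \<in> carrier G \<and> x \<in> X \<and> tree_edge g x},
        tail = fst, head = (\<lambda>(g, a). g \<otimes> a)\<rparr>"

lemma cayley_simps [simp]:
  "verts \<Gamma> = carrier G" "arcs \<Gamma> = carrier G \<times> X" "tail \<Gamma> = fst" "head \<Gamma> (g, a) = g \<otimes> a"
  by (auto simp: cayley_graph_def)

lemma T_simps [simp]:
  "verts T = carrier G" "(g, x) \<in> arcs T \<longleftrightarrow> g \<in> carrier G \<and> x \<in> X \<and> tree_edge g x"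
  "tail T = fst" "head T (g, a) = g \<otimes> a"
  by (auto simp: T_def)

lemma tree_edge_reverse:
  assumes "g \<in> carrier G" "x \<in> X" "tree_edge g x"
  shows "tree_edge (g \<otimes> x) (inv x)"
  using assms by (auto simp: tree_edge_def m_assoc)

lemma reverse_edge_T: "e \<in> arcs T \<Longrightarrow> reverse_edge G e \<in> arcs T"
  using tree_edge_reverse by (cases e) (auto simp: reverse_edge_def inv_X)

sublocale \<Gamma>: wf_digraph \<Gamma>
  by unfold_locales auto

sublocale T: wf_digraph T
  by unfold_locales auto

lemma symmetric_T: "symmetric T"
  unfolding symmetric_conv
proof
  fix e assume e: "e \<in> arcs T"
  obtain g x where "e = (g, x)" by (cases e)
  with e show "\<exists>e'\<in>arcs T. tail T e = head T e' \<and> head T e = tail T e'"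
    using reverse_edge_T[OF e] by (intro bexI[of _ "reverse_edge G e"])
      (auto simp: reverse_edge_def m_assoc)
qed

lemma T_reachable_one: "g \<in> carrier G \<Longrightarrow> \<one> \<rightarrow>\<^sup>*\<^bsub>T\<^esub> g"
proof (induction rule: nf_induct)
  case one
  show ?case by simp
next
  case (ext g x)
  then have "(g, x) \<in> arcs T" by (simp add: tree_edge_def)
  from T.in_arcs_imp_in_arcs_ends[OF this] have "g \<rightarrow>\<^bsub>T\<^esub> (g \<otimes> x)" by simp
  with ext show ?case by (meson T.reachable_adj_trans)
qed

lemma T_reachable:
  assumes "g \<in> carrier G" "h \<in> carrier G"
  shows "g \<rightarrow>\<^sup>*\<^bsub>T\<^esub> h"
  using T_reachable_one[OF assms(2)] symmetric_reachable[OF symmetric_T T_reachable_one[OF assms(1)]]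
  by (rule T.reachable_trans[rotated])

lemma connected_T: "connected T"
  unfolding connected_def
proof (rule strongly_connectedI)
  show "verts (with_proj (mk_symmetric T)) \<noteq> {}" by auto
  show "u \<rightarrow>\<^sup>*\<^bsub>with_proj (mk_symmetric T)\<^esub> v"
    if "u \<in> verts (with_proj (mk_symmetric T))" "v \<in> verts (with_proj (mk_symmetric T))" for u v
    using that by (auto intro: T.reachable_mk_symmetricI T_reachable)
qed

text \<open>Replaces the recursion in \<open>cas\<close> by access through indices, as needed for
  the cyclic indices in \<open>no_cycle_T\<close>.\<close>

lemma (in -) cas_nth:
  assumes "pre_digraph.cas H u p v"
  shows "i < length p \<Longrightarrow> tail H (p ! i) = (u # map (head H) p) ! i"
    and "last (u # map (head H) p) = v"
proof -
  have "(\<forall>i<length p. tail H (p ! i) = (u # map (head H) p) ! i) \<and> last (u # map (head H) p) = v"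
    using assms
  proof (induction p arbitrary: u)
    case Nil
    then show ?case by (simp add: pre_digraph.cas.simps)
  next
    case (Cons e p)
    then have "tail H e = u" and *: "pre_digraph.cas H (head H e) p v"
      by (simp_all add: pre_digraph.cas.simps)
    then show ?case
      using Cons.IH[OF *] by (auto simp: less_Suc_eq_0_disj)
  qed
  then show "i < length p \<Longrightarrow> tail H (p ! i) = (u # map (head H) p) ! i"
    and "last (u # map (head H) p) = v" by auto
qed

text \<open>
  At a vertex of a cycle whose normal form has maximal length, both neighbours are its parent.
\<close>

lemma no_cycle_T: "\<not> (\<exists>p. T.cycle p \<and> 3 \<le> length p)"
proof
  assume "\<exists>p. T.cycle p \<and> 3 \<le> length p"
  then obtain p u where p: "T.awalk u p u" and dist: "distinct (tl (T.awalk_verts u p))"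
    and len: "3 \<le> length p"
    by (auto simp: T.cycle_def)
  define n where "n = length p"
  define f where "f i = head T (p ! i)" for i
  from p have arcs: "set p \<subseteq> arcs T" and cas: "T.cas u p u"
    by (auto simp: T.awalk_def)
  have "tl (T.awalk_verts u p) = map (head T) p"
    using len by (auto simp: T.awalk_verts_conv'[OF cas])
  with dist have inj: "i = j" if "f i = f j" "i < n" "j < n" for i j
    using that by (auto simp: f_def n_def distinct_conv_nth)
  have last: "f (n - 1) = u"
    using cas_nth(2)[OF cas] len by (cases p rule: rev_cases) (auto simp: f_def n_def nth_append)
  \<comment> \<open>Indices are cyclic: arc \<open>i\<close> runs from the vertex
    \<open>f (pred i)\<close> to the vertex \<open>f i\<close>, and \<open>f (n - 1)\<close> is the
    base point \<open>u\<close>.\<close>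
  define pred where "pred i = (if i = 0 then n - 1 else i - 1)" for i
  have tail: "tail T (p ! i) = f (pred i)" if "i < n" for i
    using that cas_nth(1)[OF cas, of i] last
    by (auto simp: n_def pred_def f_def nth_Cons')
  have arc: "p ! i \<in> arcs T" if "i < n" for i
    using arcs that by (auto simp: n_def)
  define d where "d i = length (nf (f i))" for i
  have pred_less: "pred i < n" if "i < n" for i
    using that by (auto simp: pred_def)
  have nbr: "\<exists>x. nf (f i) = nf (f (pred i)) @ [x] \<or> nf (f (pred i)) = nf (f i) @ [x]"
    and fc: "f i \<in> carrier G" if "i < n" for i
    using arc[OF that] tail[OF that] by (cases "p ! i"; auto simp: tree_edge_def f_def)+
  obtain i where i: "i < n" and max: "\<And>j. j < n \<Longrightarrow> d j \<le> d i"
  proof -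
    have "finite (d ` {..<n})" "d ` {..<n} \<noteq> {}" using len by (auto simp: n_def lessThan_empty_iff)
    from Max_in[OF this] obtain i where "i < n" "d i = Max (d ` {..<n})" by auto
    then show ?thesis using that[of i] by auto
  qed
  define j where "j = (if Suc i = n then 0 else Suc i)"
  have j: "j < n" "pred j = i" using i by (auto simp: j_def pred_def)
  \<comment> \<open>The second alternative of \<open>nbr\<close> would give the neighbour a longer
    normal form, against maximality.\<close>
  from nbr[OF i] max[OF pred_less[OF i]] obtain x where "nf (f i) = nf (f (pred i)) @ [x]"
    by (auto simp: d_def)
  moreover from nbr[OF j(1)] max[OF j(1)] j obtain y where "nf (f i) = nf (f j) @ [y]"
    by (auto simp: d_def)
  ultimately have "nf (f (pred i)) = nf (f j)" by simp
  then have "f (pred i) = f j"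
    using inj_on_nf fc i j pred_less by (auto simp: inj_on_def)
  then have "pred i = j" using inj i j pred_less by blast
  \<comment> \<open>The predecessor and the successor of a cyclic index coincide only when there are
    at most two indices.\<close>
  then show False using len i by (auto simp: pred_def j_def n_def split: if_splits)
qed

text \<open>\<open>T\<close> contains all vertices, so a larger subgraph has an additional edge, and
  the tree path from its head back to its tail closes a cycle. That path is not empty because the
  label is not the identity, and not a single edge because this would be the reverse of the
  additional edge, while \<open>T\<close> is closed under reversal.\<close>

lemma maximal_tree_T: "maximal_tree T \<Gamma>"
  unfolding maximal_tree_def \<Gamma>.max_subgraph_def
proof (intro conjI allI impI notI; (elim conjE)?)
  show "subgraph T \<Gamma>"
    unfolding subgraph_def compatible_def
    using T.wf_digraph \<Gamma>.wf_digraph by (auto simp: T_def cayley_graph_def)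
  show "undirected_tree T"
    unfolding undirected_tree_def using symmetric_T connected_T no_cycle_T by blast
  fix H assume H: "H \<noteq> T" "subgraph T H" "subgraph H \<Gamma>" "undirected_tree H"
  interpret H: wf_digraph H using H(2) by (simp add: subgraph_def)
  have sub: "arcs T \<subseteq> arcs H" "arcs H \<subseteq> arcs \<Gamma>" and verts: "verts H = carrier G"
    and th: "tail H = tail T" "head H = head T"
    using H(2,3) by (auto simp: subgraph_def compatible_def)
  have "arcs H \<noteq> arcs T"
    using H(1) verts th by (metis T_simps(1) pre_digraph.equality old.unit.exhaust)
  with sub(1) obtain g x where e: "(g, x) \<in> arcs H" "(g, x) \<notin> arcs T" by fast
  with sub have gx: "g \<in> carrier G" "x \<in> X" "\<not> tree_edge g x" by auto
  from gx have "(g \<otimes> x) \<rightarrow>\<^sup>*\<^bsub>T\<^esub> g" by (intro T_reachable) auto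
  then obtain p where p: "T.apath (g \<otimes> x) p g" by (metis T.reachable_apath)
  then have aw: "T.awalk (g \<otimes> x) p g" and dist: "distinct (T.awalk_verts (g \<otimes> x) p)"
    by (auto simp: T.apath_def)
  have "p \<noteq> []"
    using aw gx one_notin_X by (auto simp: T.awalk_Nil_iff l_cancel_one')
  moreover have "length p \<noteq> 1"
  proof
    assume "length p = 1"
    then obtain h y where "p = [(h, y)]" by (metis One_nat_def length_0_conv length_Suc_conv surj_pair)
    with aw have hy: "(h, y) \<in> arcs T" "h = g \<otimes> x" "h \<otimes> y = g" by (auto simp: T.awalk_simps)
    then have "y \<in> carrier G" by simp
    with hy gx have "y = inv x"
      by (metis X_closed inv_equality l_cancel_one' m_assoc m_closed inv_comm inv_inv)
    with reverse_edge_T[OF hy(1)] hy gx show False by (simp add: reverse_edge_def)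
  qed
  ultimately have len: "3 \<le> length ((g, x) # p)"
    by (cases p) (auto simp: Suc_le_eq)
  have comp: "compatible T H" using th by (simp add: compatible_def)
  have "H.awalk (g \<otimes> x) p g"
    using aw sub verts compatible_cas[OF comp] by (auto simp: T.awalk_def H.awalk_def)
  then have "H.awalk g ((g, x) # p) g"
    using e th by (simp add: H.awalk_Cons_iff)
  moreover have "tl (H.awalk_verts g ((g, x) # p)) = T.awalk_verts (g \<otimes> x) p"
    using th compatible_awalk_verts[OF comp] by simp
  ultimately have "H.cycle ((g, x) # p)"
    using dist unfolding H.cycle_def by auto
  with len H(4) show False by (auto simp: undirected_tree_def)
qed

lemma awalk_edge_path:
  assumes "g \<in> carrier G" "w \<in> lists X" "foldl (\<otimes>) g w = h"
  shows "\<Gamma>.awalk g (edge_path G g w) h"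
  using assms by (induction w arbitrary: g) (auto simp: \<Gamma>.awalk_simps)

lemma T_awalk_snoc:
  "T.awalk u (p @ [(g, x)]) v \<longleftrightarrow> T.awalk u p g \<and> (g, x) \<in> arcs T \<and> v = g \<otimes> x"
  by (auto simp: T.awalk_simps)

lemma non_backtracking_snoc:
  "non_backtracking G (p @ [e]) \<longleftrightarrow> non_backtracking G p \<and> (p \<noteq> [] \<longrightarrow> e \<noteq> reverse_edge G (last p))"
proof (cases p rule: rev_cases)
  case Nil
  then show ?thesis by (simp add: non_backtracking_def)
next
  case (snoc q f)
  have "(\<forall>i<Suc (length q). P i) \<longleftrightarrow> (\<forall>i<length q. P i) \<and> P (length q)" for P
    by (auto simp: less_Suc_eq)
  then show ?thesis
    by (auto simp: non_backtracking_def snoc nth_append less_Suc_eq)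
qed

lemma T_awalk_nf:
  assumes "g \<in> carrier G"
  shows "\<exists>p. T.awalk \<one> p g \<and> non_backtracking G p \<and> map snd p = nf g"
  using assms
proof (induction rule: nf_induct)
  case one
  have "nf \<one> = []" by (simp add: nf_Nil_iff)
  then show ?case by (auto simp: T.awalk_simps non_backtracking_def intro!: exI[of _ "[]"])
next
  case (ext g x)
  then obtain p where p: "T.awalk \<one> p g" "non_backtracking G p" "map snd p = nf g" by blast
  moreover have "(g, x) \<in> arcs T" using ext by (simp add: tree_edge_def)
  moreover have "(g, x) \<noteq> reverse_edge G (last p)" if "p \<noteq> []"
  proof
    assume rev: "(g, x) = reverse_edge G (last p)"
    obtain q h y where q: "p = q @ [(h, y)]"
      using \<open>p \<noteq> []\<close> by (metis append_butlast_last_id surj_pair)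
    with rev have "x = inv y" by (simp add: reverse_edge_def)
    moreover have "nf (g \<otimes> inv y) = map snd q"
      using ext(1) p(3) q by (intro nf_prefix) auto
    ultimately show False using ext(3) p(3) q by simp
  qed
  ultimately show ?case
    using ext(3) by (intro exI[of _ "p @ [(g, x)]"])
      (simp add: T_awalk_snoc non_backtracking_snoc del: T.awalk_append_iff)
qed

text \<open>After arriving at \<open>h\<close> along a path labelled \<open>nf h\<close>, a step to
  the parent of \<open>h\<close> would reverse the last edge. So a path without backtracking always
  steps to a child, which appends one letter to the normal form.\<close>

lemma map_snd_T_awalk:
  assumes "T.awalk \<one> p g" "non_backtracking G p"
  shows "map snd p = nf g"
  using assms
proof (induction p arbitrary: g rule: rev_induct)
  case Nil
  then have "g = \<one>" by (simp add: T.awalk_Nil_iff)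
  then show ?case using nf_Nil_iff[of \<one>] by simp
next
  case (snoc e p)
  obtain h x where e: "e = (h, x)" by (cases e)
  from snoc.prems have p: "T.awalk \<one> p h" "non_backtracking G p"
    and hx: "h \<in> carrier G" "x \<in> X" "tree_edge h x" "g = h \<otimes> x"
    and rev: "p \<noteq> [] \<longrightarrow> (h, x) \<noteq> reverse_edge G (last p)"
    by (simp_all add: e T_awalk_snoc non_backtracking_snoc del: T.awalk_append_iff)
  have IH: "map snd p = nf h" using snoc.IH[OF p] .
  have "nf h \<noteq> nf (h \<otimes> x) @ [inv x]"
  proof
    assume nf: "nf h = nf (h \<otimes> x) @ [inv x]"
    with IH obtain q h' where q: "p = q @ [(h', inv x)]"
      by (auto simp: map_eq_append_conv)
    with p(1) have "h = h' \<otimes> inv x"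
      by (simp add: T_awalk_snoc del: T.awalk_append_iff)
    with rev q hx show False by (simp add: reverse_edge_def)
  qed
  with hx IH show ?case by (simp add: e tree_edge_def)
qed

lemma T_awalk_eq_edge_path: "T.awalk g p h \<Longrightarrow> p = edge_path G g (map snd p)"
  by (induction p arbitrary: g) (auto simp: T.awalk_simps)

text \<open>All paths without backtracking from the identity to \<open>g\<close> carry the same
  label, and a path is determined by its start and its label; this gives the uniqueness required by
  \<open>THE\<close>.\<close>

lemma normal_form_T:
  assumes "g \<in> carrier G"
  shows "normal_form G T g = nf g"
proof -
  from T_awalk_nf[OF assms] obtain p where p: "T.awalk \<one> p g" "non_backtracking G p" "map snd p = nf g"
    by blast
  then have "(THE p. T.awalk \<one> p g \<and> non_backtracking G p) = p"
    by (intro the_equality) (metis T_awalk_eq_edge_path map_snd_T_awalk)+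
  with p show ?thesis by (simp add: normal_form_def path_label_def)
qed

end


section \<open>A criterion for autostackability\<close>

text \<open>
  The map \<open>state\<close> is a finite-index right congruence on the normal forms, i.e. an automaton
  recognizing them. The flow function replaces an edge \<open>(g, x)\<close> outside the tree by the path from
  \<open>g\<close> labelled by \<open>flow_word (state g) x\<close>.
\<close>

locale automatic_flow = prefix_closed_normal_forms +
  fixes state :: "'a \<Rightarrow> 'q" and flow_word :: "'q \<Rightarrow> 'a \<Rightarrow> 'a list"
    and r :: "(('a \<times> 'a) \<times> ('a \<times> 'a)) set"
  assumes finite_X: "finite X"
    and finite_state: "finite (state ` carrier G)"
    and state_cong: "\<lbrakk>g \<in> carrier G; h \<in> carrier G; x \<in> X; state g = state h;
        nf (g \<otimes> x) = nf g @ [x]\<rbrakk> \<Longrightarrow> nf (h \<otimes> x) = nf h @ [x] \<and> state (h \<otimes> x) = state (g \<otimes> x)"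
    and flow_word_lists: "\<lbrakk>g \<in> carrier G; x \<in> X\<rbrakk> \<Longrightarrow> flow_word (state g) x \<in> lists X"
    and flow_word_eval: "\<lbrakk>g \<in> carrier G; x \<in> X\<rbrakk>
        \<Longrightarrow> foldl (\<otimes>) g (flow_word (state g) x) = g \<otimes> x"
    and flow_word_tree: "\<lbrakk>g \<in> carrier G; x \<in> X; tree_edge g x\<rbrakk> \<Longrightarrow> flow_word (state g) x = [x]"
    and wf_r: "wf r"
    and flow_word_less: "\<lbrakk>g \<in> carrier G; x \<in> X; \<not> tree_edge g x;
        (h, y) \<in> set (edge_path G g (flow_word (state g) x)); \<not> tree_edge h y\<rbrakk>
        \<Longrightarrow> ((h, y), (g, x)) \<in> r"
begin

definition \<Phi> :: "'a \<times> 'a \<Rightarrow> ('a \<times> 'a) list" where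
  "\<Phi> = (\<lambda>(g, x). edge_path G g (flow_word (state g) x))"

lemma flow_function_\<Phi>: "flow_function \<Gamma> T \<Phi>"
proof -
  let ?s = "{(e', e). e \<in> arcs \<Gamma> \<and> e' \<in> set (\<Phi> e) \<and> e \<notin> arcs T \<and> e' \<notin> arcs T}"
  have awalk: "\<Gamma>.awalk (tail \<Gamma> e) (\<Phi> e) (head \<Gamma> e)" if "e \<in> arcs \<Gamma>" for e
    using that awalk_edge_path[OF _ flow_word_lists flow_word_eval]
    by (cases e) (simp add: \<Phi>_def)
  have "?s \<subseteq> r"
  proof clarify
    fix h y g x
    assume gx: "(g, x) \<in> arcs \<Gamma>" "(h, y) \<in> set (\<Phi> (g, x))" "(g, x) \<notin> arcs T" "(h, y) \<notin> arcs T"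
    with awalk[OF gx(1)] have "(h, y) \<in> arcs \<Gamma>" by (auto simp: \<Gamma>.awalk_def)
    with gx show "((h, y), (g, x)) \<in> r"
      by (intro flow_word_less) (auto simp: \<Phi>_def)
  qed
  then have wf: "wf (flow_order \<Gamma> T \<Phi>)"
    unfolding flow_order_def using wf_subset[OF wf_r] wf_trancl by blast
  then have "irrefl (flow_order \<Gamma> T \<Phi>)"
    by (auto simp: irrefl_def)
  with wf awalk show ?thesis
    unfolding flow_function_def
    by (auto simp: flow_order_def \<Phi>_def flow_word_tree)
qed

definition flow_words :: "'a list set" where
  "flow_words = (\<lambda>(q, x). flow_word q x) ` (state ` carrier G \<times> X)"

lemma finite_flow_words: "finite flow_words"
  unfolding flow_words_def using finite_X finite_state by blast

lemma flow_words_lists: "u \<in> flow_words \<Longrightarrow> u \<in> lists X"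
  using flow_word_lists by (auto simp: flow_words_def)

lemma bounded_flow_\<Phi>: "bounded_flow \<Gamma> \<Phi>"
proof -
  have "length (\<Phi> e) \<le> Max (length ` flow_words)" if "e \<in> arcs \<Gamma>" for e
  proof -
    obtain g x where e: "e = (g, x)" by (cases e)
    with that have "flow_word (state g) x \<in> flow_words" by (auto simp: flow_words_def)
    with e show ?thesis using finite_flow_words by (simp add: \<Phi>_def)
  qed
  then show ?thesis by (auto simp: bounded_flow_def)
qed

text \<open>The automaton remembers the state of the element spelled so far. A transition is
  computed at some element with that state which admits the letter; \<open>state_cong\<close> makes
  the choice irrelevant. If no such element exists, the automaton dies.\<close>

lemma regular_normal_forms:
  "regular_language X {nf g | g. g \<in> carrier G \<and> state g \<in> S}"
proof -
  define \<delta> where "\<delta> s x = (case s of None \<Rightarrow> None | Some q \<Rightarrow>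
      if \<exists>g\<in>carrier G. state g = q \<and> nf (g \<otimes> x) = nf g @ [x]
      then Some (state ((SOME g. g \<in> carrier G \<and> state g = q \<and> nf (g \<otimes> x) = nf g @ [x]) \<otimes> x))
      else None)" for s x
  have \<delta>_Some: "\<delta> (Some (state g)) x = Some (state (g \<otimes> x))"
    if "g \<in> carrier G" "x \<in> X" "nf (g \<otimes> x) = nf g @ [x]" for g x
  proof -
    define h where "h = (SOME h. h \<in> carrier G \<and> state h = state g \<and> nf (h \<otimes> x) = nf h @ [x])"
    have "h \<in> carrier G \<and> state h = state g \<and> nf (h \<otimes> x) = nf h @ [x]"
      unfolding h_def by (rule someI[of _ g]) (simp add: that)
    then have "state (h \<otimes> x) = state (g \<otimes> x)"
      using state_cong[of g h x] that by simp
    moreover have "\<exists>h\<in>carrier G. state h = state g \<and> nf (h \<otimes> x) = nf h @ [x]"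
      using that by blast
    ultimately show ?thesis by (simp add: \<delta>_def h_def)
  qed
  have \<delta>_SomeD: "\<exists>g\<in>carrier G. s = Some (state g) \<and> nf (g \<otimes> x) = nf g @ [x]"
    if "\<delta> s x = Some q" for s x q
    using that by (cases s) (auto simp: \<delta>_def split: if_splits)
  have run: "foldl \<delta> (Some (state \<one>)) w = Some q \<longleftrightarrow> (\<exists>g\<in>carrier G. nf g = w \<and> state g = q)"
    if "w \<in> lists X" for w q
    using that
  proof (induction w arbitrary: q rule: rev_induct)
    case Nil
    show ?case using nf_Nil_iff by auto
  next
    case (snoc x w)
    then have w: "w \<in> lists X" and x: "x \<in> X" by auto
    show ?case
    proof
      assume l: "foldl \<delta> (Some (state \<one>)) (w @ [x]) = Some q"
      then obtain p where "foldl \<delta> (Some (state \<one>)) w = Some p"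
        by (cases "foldl \<delta> (Some (state \<one>)) w") (auto simp: \<delta>_def)
      moreover with snoc.IH[OF w] obtain g where g: "g \<in> carrier G" "nf g = w" "state g = p" by auto
      ultimately have "foldl \<delta> (Some (state \<one>)) w = Some (state g)" by simp
      with l have "\<delta> (Some (state g)) x = Some q" by simp
      from \<delta>_SomeD[OF this] obtain h
        where "h \<in> carrier G" "state h = state g" "nf (h \<otimes> x) = nf h @ [x]" by auto
      then have "nf (g \<otimes> x) = nf g @ [x]" using g x state_cong[of h g x] by simp
      with g x \<delta>_Some[OF g(1) x this] \<open>\<delta> (Some (state g)) x = Some q\<close>
      show "\<exists>g\<in>carrier G. nf g = w @ [x] \<and> state g = q"
        by (intro bexI[of _ "g \<otimes> x"]) auto
    next
      assume "\<exists>g\<in>carrier G. nf g = w @ [x] \<and> state g = q"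
      then obtain g where g: "g \<in> carrier G" "nf g = w @ [x]" "state g = q" by blast
      obtain h where h: "h \<in> carrier G" "g = h \<otimes> x" "nf h = w"
        using nf_snocE[OF g(1,2)] by metis
      then have "foldl \<delta> (Some (state \<one>)) w = Some (state h)"
        using snoc.IH[OF w] by blast
      with \<delta>_Some[of h x] g h x show "foldl \<delta> (Some (state \<one>)) (w @ [x]) = Some q" by simp
    qed
  qed
  show ?thesis
  proof (rule regular_languageI[where Q = "insert None (Some ` state ` carrier G)"
        and init = "Some (state \<one>)" and \<delta> = \<delta> and F = "Some ` S"])
    show "finite (insert None (Some ` state ` carrier G))" using finite_state by simp
    show "Some (state \<one>) \<in> insert None (Some ` state ` carrier G)" by simp
    show "\<delta> s x \<in> insert None (Some ` state ` carrier G)"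
      if "s \<in> insert None (Some ` state ` carrier G)" "x \<in> X" for s x
    proof (cases "\<delta> s x")
      case (Some q)
      then obtain g where "g \<in> carrier G" "s = Some (state g)" "nf (g \<otimes> x) = nf g @ [x]"
        using \<delta>_SomeD by blast
      with Some \<delta>_Some[of g x] that(2) show ?thesis by auto
    qed simp
    show "{nf g |g. g \<in> carrier G \<and> state g \<in> S} =
        {w \<in> lists X. foldl \<delta> (Some (state \<one>)) w \<in> Some ` S}"
    proof (rule Set.set_eqI)
      fix w
      show "w \<in> {nf g |g. g \<in> carrier G \<and> state g \<in> S} \<longleftrightarrow>
          w \<in> {w \<in> lists X. foldl \<delta> (Some (state \<one>)) w \<in> Some ` S}"
      proof (cases "w \<in> lists X")
        case True
        then show ?thesis using run[OF True] by (auto simp: image_iff)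
      next
        case False
        then show ?thesis using nf_lists by auto
      qed
    qed
  qed
qed

lemma stacking_graph_eq:
  "stacking_graph G X T \<Phi> = {[nf g, [a], flow_word (state g) a] | g a. g \<in> carrier G \<and> a \<in> X}"
proof -
  have inj: "inj_on (normal_form G T) (carrier G)"
    using inj_on_nf normal_form_T by (auto simp: inj_on_def)
  have "stacking_map G T \<Phi> (normal_form G T g) a = flow_word (state g) a" if "g \<in> carrier G" for g a
    using that by (simp add: stacking_map_def the_inv_into_f_f[OF inj] \<Phi>_def)
  then show ?thesis
    unfolding stacking_graph_def using normal_form_T by (intro Collect_cong) (metis (no_types, lifting))
qed

text \<open>The flow word depends only on the state and the letter, and only finitely many occur. So
  the graph is a finite union of sets whose last two components are fixed and whose first component
  ranges over a regular language.\<close>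

lemma synchronously_regular_\<Phi>: "synchronously_regular 3 X (stacking_graph G X T \<Phi>)"
proof -
  define L where "L a u = {nf g | g. g \<in> carrier G \<and> state g \<in> {q. flow_word q a = u}}" for a u
  have "stacking_graph G X T \<Phi> = (\<Union>(a, u)\<in>X \<times> flow_words. {[w, [a], u] | w. w \<in> L a u})"
    unfolding stacking_graph_eq L_def flow_words_def by fastforce
  then have "pad ` stacking_graph G X T \<Phi>
      = (\<Union>(a, u)\<in>X \<times> flow_words. pad ` {[w, [a], u] | w. w \<in> L a u})"
    by blast
  moreover have "regular_language (padded_alphabet 3 X) (\<Union>(a, u)\<in>X \<times> flow_words. pad ` {[w, [a], u] | w. w \<in> L a u})"
  proof (rule regular_language_UN)
    show "finite (X \<times> flow_words)" using finite_X finite_flow_words by simp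
    show "regular_language (padded_alphabet 3 X)
        (case i of (a, u) \<Rightarrow> pad ` {[w, [a], u] | w. w \<in> L a u})" if "i \<in> X \<times> flow_words" for i
    proof -
      obtain a u where i: "i = (a, u)" "a \<in> X" "u \<in> flow_words" using \<open>i \<in> X \<times> flow_words\<close> by blast
      have "regular_language X (L a u)" unfolding L_def by (rule regular_normal_forms)
      moreover have "L a u \<subseteq> lists X" using nf_lists by (auto simp: L_def)
      ultimately show ?thesis
        using i flow_words_lists regular_language_pad[of X "L a u" "[a]" u] by simp
    qed
  qed
  moreover have "stacking_graph G X T \<Phi> \<subseteq> {ws. length ws = 3 \<and> set ws \<subseteq> lists X}"
    unfolding stacking_graph_eq
  proof clarify
    fix g a assume "g \<in> carrier G" "a \<in> X"
    with nf_lists[of g] flow_word_lists[of g a]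
    show "length [nf g, [a], flow_word (state g) a] = 3 \<and> set [nf g, [a], flow_word (state g) a] \<subseteq> lists X"
      by simp
  qed
  ultimately show ?thesis by (simp add: synchronously_regular_def)
qed

theorem autostackable: "autostackable G"
  unfolding autostackable_def autostackable_over_def
  using is_group finite_X X_carrier one_notin_X inv_X generate_X maximal_tree_T
    flow_function_\<Phi> bounded_flow_\<Phi> synchronously_regular_\<Phi> by blast

end


section \<open>Normal forms of the Baumslag--Gersten group\<close>

datatype letter = LA bool | LT bool | LS bool

primrec inv_letter :: "letter \<Rightarrow> letter" where
  "inv_letter (LA c) = LA (\<not> c)"
| "inv_letter (LT c) = LT (\<not> c)"
| "inv_letter (LS c) = LS (\<not> c)"

lemma inv_inv_letter [simp]: "inv_letter (inv_letter y) = y"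
  by (cases y) auto

text \<open>
  With \<open>t = s a s\<^sup>-\<^sup>1\<close>, the group is an HNN extension of \<open>\<langle>a, t | t a = a\<^sup>2 t\<rangle>\<close> with stable letter \<open>s\<close>.
  The pair \<open>([(k\<^sub>n, y\<^sub>n), \<dots>, (k\<^sub>1, y\<^sub>1)], k)\<close> stands for \<open>a^k\<^sub>1 y\<^sub>1 \<dots> a^k\<^sub>n y\<^sub>n a^k\<close>, where every \<open>y\<^sub>i\<close> is
  one of \<open>t\<^sup>\<plusminus>\<^sup>1\<close>, \<open>s\<^sup>\<plusminus>\<^sup>1\<close>; thus lists of syllables are stored in reverse.
\<close>

type_synonym base = "(int \<times> letter) list"

fun top_letter :: "base \<Rightarrow> letter option" where
  "top_letter [] = None"
| "top_letter ((k, y) # b) = Some y"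

fun is_t_power :: "base \<Rightarrow> bool" where
  "is_t_power ((k, LT c) # b) \<longleftrightarrow> k = 0 \<and> is_t_power b"
| "is_t_power b \<longleftrightarrow> True"

text \<open>For valid \<open>b\<close>, this is the exponent \<open>j\<close> of the final segment
  without a trailing power of \<open>a\<close>. After \<open>t^n a^k\<close>, a representative when
  \<open>k\<close> is odd, the count starts afresh at 1. Once the segment is not a power of
  \<open>t\<close>, further letters \<open>a\<close> are carried to the left by
  \<open>t^j a = a^(2^j) t^j\<close>, keeping \<open>j\<close> and the parity.\<close>

fun level :: "base \<Rightarrow> int" where
  "level ((k, LT True) # b) = (if k \<noteq> 0 \<and> is_t_power b then 1 else level b + 1)"
| "level ((k, LT False) # b) = level b - 1"
| "level b = 0"

text \<open>
  \<open>is_t_power b\<close> says that the segment of \<open>b\<close> after the last letter \<open>s\<^sup>\<plusminus>\<^sup>1\<close> is a power of \<open>t\<close>;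
  \<open>t_exp\<close> is the exponent \<open>j\<close> in the decomposition \<open>h = r t\<^sup>j\<close> of the final segment in \<open>\<langle>a, t\<rangle>\<close>, where the
  representatives \<open>r\<close> of the left cosets of \<open>\<langle>t\<rangle>\<close> are \<open>1\<close> and the \<open>t\<^sup>n a\<^sup>k\<close> with \<open>k\<close> odd.
\<close>

fun t_exp :: "base \<times> int \<Rightarrow> int" where
  "t_exp (b, k) = (if is_t_power b \<and> k \<noteq> 0 then - int (multiplicity 2 k) else level b)"

text \<open>By \<open>a^2 t = t a\<close> and \<open>a t^-1 = t^-1 a^2\<close>, the exponent of
  \<open>a\<close> before \<open>t\<close> reduces to 0 or 1, and before \<open>t^-1\<close> to 0.
  By \<open>t s = s a\<close> and \<open>a s^-1 = s^-1 t\<close>, the segment before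
  \<open>s\<close> reduces to a coset representative, and the exponent before \<open>s^-1\<close> to
  0. The conditions on \<open>top_letter\<close> exclude free cancellation.\<close>

fun stable_ok :: "letter \<Rightarrow> base \<times> int \<Rightarrow> bool" where
  "stable_ok (LA c) m \<longleftrightarrow> False"
| "stable_ok (LT True) (b, k) \<longleftrightarrow> k = 1 \<or> k = 0 \<and> top_letter b \<noteq> Some (LT False)"
| "stable_ok (LT False) (b, k) \<longleftrightarrow> k = 0 \<and> top_letter b \<noteq> Some (LT True)"
| "stable_ok (LS True) (b, k) \<longleftrightarrow> t_exp (b, k) = 0 \<and> (k = 0 \<longrightarrow> top_letter b \<noteq> Some (LS False))"
| "stable_ok (LS False) (b, k) \<longleftrightarrow> k = 0 \<and> top_letter b \<noteq> Some (LS True)"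

fun valid :: "base \<Rightarrow> bool" where
  "valid [] \<longleftrightarrow> True"
| "valid ((k, y) # b) \<longleftrightarrow> valid b \<and> stable_ok y (b, k)"

abbreviation "elements \<equiv> {m. valid (fst m)}"

lemma valid_topE:
  assumes "valid b" "top_letter b = Some y"
  obtains k b' where "b = (k, y) # b'" "valid b'" "stable_ok y (b', k)"
  using assms by (cases b rule: valid.cases) auto

section \<open>Right multiplication by \<open>a\<close> and \<open>t\<close>\<close>

fun act_a :: "bool \<Rightarrow> base \<times> int \<Rightarrow> base \<times> int" where
  "act_a c (b, k) = (b, if c then k + 1 else k - 1)"

text \<open>Rests on \<open>a^k t = a^(k mod 2) t a^(k div 2)\<close>, where flooring division also
  covers negative \<open>k\<close>.\<close>

fun mult_t :: "base \<times> int \<Rightarrow> base \<times> int" where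
  "mult_t (b, k) = (if even k \<and> top_letter b = Some (LT False) then (tl b, k div 2)
     else ((k mod 2, LT True) # b, k div 2))"

text \<open>The two equations are \<open>a^k' t a^k t^-1 = a^(k' + 2 k)\<close> and
  \<open>a^k t^-1 = t^-1 a^(2 k)\<close>.\<close>

fun mult_t' :: "base \<times> int \<Rightarrow> base \<times> int" where
  "mult_t' ((k', LT True) # b, k) = (b, k' + 2 * k)"
| "mult_t' (b, k) = ((0, LT False) # b, 2 * k)"

lemma mult_t'_other: "top_letter b \<noteq> Some (LT True) \<Longrightarrow> mult_t' (b, k) = ((0, LT False) # b, 2 * k)"
  by (cases "(b, k)" rule: mult_t'.cases) auto

lemma mult_t_valid: "m \<in> elements \<Longrightarrow> mult_t m \<in> elements"
proof (cases m)
  case (Pair b k)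
  assume "m \<in> elements"
  then show ?thesis
    unfolding Pair by (cases b rule: valid.cases) (auto simp: odd_iff_mod_2_eq_one)
qed

lemma mult_t'_valid: "m \<in> elements \<Longrightarrow> mult_t' m \<in> elements"
proof (cases m)
  case (Pair b k)
  assume "m \<in> elements"
  then show ?thesis
    unfolding Pair by (cases "top_letter b = Some (LT True)") (auto simp: mult_t'_other elim: valid_topE)
qed

lemma mult_t'_mult_t:
  assumes "m \<in> elements"
  shows "mult_t' (mult_t m) = m"
proof (cases m)
  case (Pair b k)
  show ?thesis
  proof (cases "even k \<and> top_letter b = Some (LT False)")
    case True
    with assms Pair obtain b' where "b = (0, LT False) # b'" "top_letter b' \<noteq> Some (LT True)"
      by (auto elim: valid_topE)
    with True Pair show ?thesis by (simp add: mult_t'_other)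
  next
    case False
    with Pair show ?thesis by auto
  qed
qed

lemma mult_t_mult_t':
  assumes "m \<in> elements"
  shows "mult_t (mult_t' m) = m"
proof (cases m)
  case (Pair b k)
  show ?thesis
  proof (cases "top_letter b = Some (LT True)")
    case True
    with assms Pair obtain k' b' where "b = (k', LT True) # b'" "stable_ok (LT True) (b', k')"
      by (auto elim: valid_topE)
    with Pair show ?thesis by auto
  next
    case False
    with Pair show ?thesis by (simp add: mult_t'_other)
  qed
qed

text \<open>Within a segment, \<open>t^-1\<close> follows neither a nonzero power of
  \<open>a\<close> nor \<open>t\<close>, so negative letters occur only at its beginning. Once a
  letter \<open>a\<close> precedes a letter \<open>t\<close>, only positive letters follow. The
  claims support one another in the induction.\<close>

lemma valid_pure:
  assumes "valid b"
  shows "(is_t_power b \<or> level b > 0) \<and> (top_letter b \<noteq> Some (LT True) \<longrightarrow> is_t_power b \<and> level b \<le> 0) \<and>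
    (top_letter b \<noteq> Some (LT False) \<longrightarrow> level b \<ge> 0)"
  using assms
proof (induction b)
  case (Cons p b)
  obtain k y where p: "p = (k, y)" by (cases p)
  show ?case
  proof (cases y)
    case (LT c)
    with Cons p show ?thesis by (cases c) auto
  qed (auto simp: p)
qed simp

lemma level_top:
  assumes "valid b"
  shows "top_letter b = Some (LT True) \<Longrightarrow> level b > 0"
    and "top_letter b = Some (LT False) \<Longrightarrow> level b < 0"
    and "top_letter b \<noteq> Some (LT True) \<Longrightarrow> top_letter b \<noteq> Some (LT False) \<Longrightarrow> level b = 0"
    and "top_letter b \<noteq> Some (LT True) \<Longrightarrow> is_t_power b"
proof -
  show "level b > 0" if t: "top_letter b = Some (LT True)"
  proof -
    obtain k b' where b: "b = (k, LT True) # b'" "valid b'" "stable_ok (LT True) (b', k)"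
      by (rule valid_topE[OF assms t])
    with valid_pure[OF b(2)] show ?thesis by auto
  qed
  show "level b < 0" if t: "top_letter b = Some (LT False)"
  proof -
    obtain k b' where b: "b = (k, LT False) # b'" "valid b'" "stable_ok (LT False) (b', k)"
      by (rule valid_topE[OF assms t])
    with valid_pure[OF b(2)] show ?thesis by auto
  qed
  show "top_letter b \<noteq> Some (LT True) \<Longrightarrow> top_letter b \<noteq> Some (LT False) \<Longrightarrow> level b = 0"
    "top_letter b \<noteq> Some (LT True) \<Longrightarrow> is_t_power b"
    using valid_pure[OF assms] by auto
qed

lemma multiplicity_half:
  fixes k :: int
  assumes "even k" "k \<noteq> 0"
  shows "multiplicity 2 k = Suc (multiplicity 2 (k div 2))"
proof -
  from assms obtain i where "k = 2 * i" "i \<noteq> 0" by auto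
  then show ?thesis by (simp add: multiplicity_times_same)
qed

lemma multiplicity_odd: "odd (k :: int) \<Longrightarrow> multiplicity 2 k = 0"
  by (rule not_dvd_imp_multiplicity_0)

text \<open>Multiplication by \<open>t\<close> keeps the coset and raises the exponent. If
  \<open>k = 2^i l\<close> with \<open>l\<close> odd, then \<open>a^k = t^i a^l t^-i\<close>, whence
  the negative multiplicity in \<open>t_exp\<close>: halving an even \<open>k\<close> removes one
  factor 2, and at an odd \<open>k\<close> after a power of \<open>t\<close> the count in
  \<open>level\<close> starts at 1.\<close>

lemma t_exp_mult_t:
  assumes "m \<in> elements"
  shows "t_exp (mult_t m) = t_exp m + 1"
proof (cases m)
  case (Pair b k)
  with assms have b: "valid b" by simp
  show ?thesis
  proof (cases "even k")
    case True
    show ?thesis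
    proof (cases "top_letter b = Some (LT False)")
      case top_letter: True
      with b obtain b' where "b = (0, LT False) # b'" by (auto elim: valid_topE)
      moreover have "is_t_power b" using level_top(4)[OF b] top_letter by simp
      ultimately show ?thesis using True by (auto simp: Pair multiplicity_half)
    next
      case False
      with True show ?thesis by (auto simp: Pair multiplicity_half)
    qed
  next
    case False
    then show ?thesis by (auto simp: Pair multiplicity_odd odd_iff_mod_2_eq_one)
  qed
qed

lemma mult_t_twice_a: "mult_t (b, k + 2) = act_a True (mult_t (b, k))"
proof -
  have "(k + 2) mod 2 = k mod 2" "(k + 2) div 2 = k div 2 + 1" by presburger+
  then show ?thesis by simp
qed

section \<open>Integer powers of \<open>t\<close> and representatives of the left cosets of its
  subgroup\<close>

definition pow_t :: "int \<Rightarrow> base \<times> int \<Rightarrow> base \<times> int" where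
  "pow_t i m = (if 0 \<le> i then (mult_t ^^ nat i) m else (mult_t' ^^ nat (- i)) m)"

lemma pow_t_0 [simp]: "pow_t 0 m = m"
  by (simp add: pow_t_def)

lemma pow_t_valid: "m \<in> elements \<Longrightarrow> pow_t i m \<in> elements"
proof -
  assume m: "m \<in> elements"
  have "(mult_t ^^ n) m \<in> elements" "(mult_t' ^^ n) m \<in> elements" for n
    using m mult_t_valid mult_t'_valid by (induction n) auto
  then show ?thesis by (simp add: pow_t_def)
qed

lemma pow_t_Suc:
  assumes "m \<in> elements"
  shows "pow_t (i + 1) m = mult_t (pow_t i m)"
proof (cases "0 \<le> i")
  case True
  then have "nat (i + 1) = Suc (nat i)" by simp
  with True show ?thesis by (simp add: pow_t_def)
next
  case False
  \<comment> \<open>So \<open>i = - (n + 1)\<close>: \<open>n\<close> counts the factors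
    \<open>t^-1\<close> that remain after one has been cancelled.\<close>
  define n where "n = nat (- i - 1)"
  have n: "nat (- i) = Suc n" "nat (- i - 1) = n" using False by (auto simp: n_def)
  have "pow_t (i + 1) m = (mult_t' ^^ n) m"
    using False n by (cases "i = - 1") (auto simp: pow_t_def)
  moreover have "(mult_t' ^^ n) m \<in> elements"
    using assms mult_t'_valid by (induction n) auto
  moreover have "pow_t i m = mult_t' ((mult_t' ^^ n) m)"
    using False n by (simp add: pow_t_def)
  ultimately show ?thesis by (simp add: mult_t_mult_t')
qed

lemma pow_t_pred: "m \<in> elements \<Longrightarrow> pow_t (i - 1) m = mult_t' (pow_t i m)"
  using pow_t_Suc[of m "i - 1"] mult_t'_mult_t[OF pow_t_valid, of m "i - 1"] by simp

lemma pow_t_add: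
  assumes "m \<in> elements"
  shows "pow_t (i + j) m = pow_t i (pow_t j m)"
proof (induction i rule: int_induct[where k = 0])
  case (step1 i)
  then show ?case
    using pow_t_Suc[OF assms, of "i + j"] pow_t_Suc[OF pow_t_valid[OF assms], of i j] by (simp add: ac_simps)
next
  case (step2 i)
  then show ?case
    using pow_t_pred[OF assms, of "i + j"] pow_t_pred[OF pow_t_valid[OF assms], of i j] by (simp add: algebra_simps)
qed simp

lemma t_exp_pow_t:
  assumes "m \<in> elements"
  shows "t_exp (pow_t i m) = t_exp m + i"
proof (induction i rule: int_induct[where k = 0])
  case (step1 i)
  then show ?case
    using pow_t_Suc[OF assms, of i] t_exp_mult_t[OF pow_t_valid[OF assms], of i] by simp
next
  case (step2 i)
  then show ?case
    using pow_t_Suc[OF assms, of "i - 1"] t_exp_mult_t[OF pow_t_valid[OF assms], of "i - 1"] by simp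
qed simp

text \<open>The representative \<open>r\<close> in \<open>h = r t^j\<close>, obtained by cancelling
  \<open>t^j\<close>.\<close>

definition coset_rep :: "base \<times> int \<Rightarrow> base \<times> int" where
  "coset_rep m = pow_t (- t_exp m) m"

lemma coset_rep:
  assumes "m \<in> elements"
  shows "coset_rep m \<in> elements" "t_exp (coset_rep m) = 0" "pow_t (t_exp m) (coset_rep m) = m"
proof -
  show "coset_rep m \<in> elements" "t_exp (coset_rep m) = 0"
    using assms pow_t_valid[OF assms] t_exp_pow_t[OF assms] by (simp_all add: coset_rep_def del: t_exp.simps)
  show "pow_t (t_exp m) (coset_rep m) = m"
    using pow_t_add[OF assms, of "t_exp m" "- t_exp m"] by (simp add: coset_rep_def)
qed

lemma coset_rep_pow_t:
  assumes "m \<in> elements"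
  shows "coset_rep (pow_t i m) = coset_rep m"
  using pow_t_add[OF assms, of "- t_exp m - i" i] t_exp_pow_t[OF assms, of i]
  by (simp add: coset_rep_def)

text \<open>From \<open>r t^j s = r s a^j\<close>; the letter \<open>s\<close> cancels if
  \<open>r\<close> ends with \<open>s^-1\<close>.\<close>

definition mult_s :: "base \<times> int \<Rightarrow> base \<times> int" where
  "mult_s m = (case coset_rep m of (b, k) \<Rightarrow>
     if k = 0 \<and> top_letter b = Some (LS False) then (tl b, t_exp m) else ((k, LS True) # b, t_exp m))"

text \<open>The two equations are \<open>a^k' s a^k s^-1 = a^k' t^k\<close> and
  \<open>a^k s^-1 = s^-1 t^k\<close>.\<close>

fun mult_s' :: "base \<times> int \<Rightarrow> base \<times> int" where
  "mult_s' ((k', LS True) # b, k) = pow_t k (b, k')"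
| "mult_s' (b, k) = pow_t k ((0, LS False) # b, 0)"

lemma mult_s'_other: "top_letter b \<noteq> Some (LS True) \<Longrightarrow> mult_s' (b, k) = pow_t k ((0, LS False) # b, 0)"
  by (cases "(b, k)" rule: mult_s'.cases) auto

lemma mult_s_valid: "m \<in> elements \<Longrightarrow> mult_s m \<in> elements"
  using coset_rep[of m]
  by (cases "coset_rep m") (auto simp: mult_s_def elim: valid_topE)

lemma mult_s'_valid:
  assumes "m \<in> elements"
  shows "mult_s' m \<in> elements"
proof (cases m)
  case (Pair b k)
  show ?thesis
  proof (cases "top_letter b = Some (LS True)")
    case True
    with assms Pair obtain k' b' where "b = (k', LS True) # b'" "valid b'"
      by (auto elim: valid_topE)
    with Pair show ?thesis using pow_t_valid[of "(b', k')" k] by simp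
  next
    case False
    with assms Pair show ?thesis
      using pow_t_valid[of "((0, LS False) # b, 0)" k] by (simp add: mult_s'_other)
  qed
qed

lemma mult_s'_mult_s:
  assumes "m \<in> elements"
  shows "mult_s' (mult_s m) = m"
proof -
  obtain b k where r: "coset_rep m = (b, k)" by (cases "coset_rep m")
  note c = coset_rep[OF assms, unfolded r]
  show ?thesis
  proof (cases "k = 0 \<and> top_letter b = Some (LS False)")
    case True
    with c obtain b' where "b = (0, LS False) # b'" "top_letter b' \<noteq> Some (LS True)"
      by (auto elim: valid_topE)
    with True c(3) show ?thesis by (simp add: mult_s_def r mult_s'_other)
  next
    case False
    with c(3) show ?thesis by (auto simp: mult_s_def r)
  qed
qed

lemma coset_rep_trivial: "t_exp m = 0 \<Longrightarrow> coset_rep m = m"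
  by (simp add: coset_rep_def)

lemma mult_s_mult_s':
  assumes "m \<in> elements"
  shows "mult_s (mult_s' m) = m"
proof (cases m)
  case (Pair b k)
  show ?thesis
  proof (cases "top_letter b = Some (LS True)")
    case True
    with assms Pair obtain k' b' where b: "b = (k', LS True) # b'" and v: "(b', k') \<in> elements"
      and ok: "stable_ok (LS True) (b', k')"
      by (auto elim: valid_topE)
    have "coset_rep (pow_t k (b', k')) = (b', k')"
      using coset_rep_pow_t[OF v] ok coset_rep_trivial[of "(b', k')"] by simp
    moreover have "t_exp (pow_t k (b', k')) = k"
      using t_exp_pow_t[OF v] ok by simp
    ultimately show ?thesis using ok by (auto simp: Pair b mult_s_def)
  next
    case False
    define n where "n = ((0 :: int, LS False) # b, 0 :: int)"
    have n: "n \<in> elements" "t_exp n = 0" using assms Pair False by (auto simp: n_def)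
    then have "coset_rep (pow_t k n) = n" "t_exp (pow_t k n) = k"
      using coset_rep_pow_t[OF n(1)] coset_rep_trivial t_exp_pow_t[OF n(1)] by auto
    with False show ?thesis by (simp add: Pair mult_s'_other mult_s_def flip: n_def) (simp add: n_def)
  qed
qed

lemma mult_s_mult_t:
  assumes "m \<in> elements"
  shows "mult_s (mult_t m) = act_a True (mult_s m)"
proof -
  have "mult_t m = pow_t 1 m" using pow_t_Suc[OF assms, of 0] by simp
  then have "coset_rep (mult_t m) = coset_rep m" using coset_rep_pow_t[OF assms] by simp
  then show ?thesis
    by (simp add: mult_s_def t_exp_mult_t[OF assms] split: prod.splits)
qed

section \<open>The action of the letters and the relations that it satisfies\<close>

fun act :: "letter \<Rightarrow> base \<times> int \<Rightarrow> base \<times> int" where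
  "act (LA c) m = act_a c m"
| "act (LT c) m = (if c then mult_t m else mult_t' m)"
| "act (LS c) m = (if c then mult_s m else mult_s' m)"

lemma act_valid:
  assumes "m \<in> elements"
  shows "act y m \<in> elements"
proof (cases y)
  case (LA c)
  with assms show ?thesis by (cases m) simp
next
  case (LT c)
  then show ?thesis using mult_t_valid[OF assms] mult_t'_valid[OF assms] by simp
next
  case (LS c)
  then show ?thesis using mult_s_valid[OF assms] mult_s'_valid[OF assms] by simp
qed

lemma act_inv_act:
  assumes "m \<in> elements"
  shows "act (inv_letter y) (act y m) = m"
proof (cases y)
  case (LA c)
  then show ?thesis by (cases m) simp
next
  case (LT c)
  then show ?thesis using mult_t'_mult_t[OF assms] mult_t_mult_t'[OF assms] by simp
next
  case (LS c)
  then show ?thesis using mult_s'_mult_s[OF assms] mult_s_mult_s'[OF assms] by simp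
qed

lemma act_act_inv: "m \<in> elements \<Longrightarrow> act y (act (inv_letter y) m) = m"
  using act_inv_act[of m "inv_letter y"] by simp

declare act.simps [simp del]

text \<open>Letters act by multiplication on the right, so nested applications are read from the
  inside out: this is \<open>a a t = t a\<close>.\<close>

lemma act_t_twice_a:
  "m \<in> elements \<Longrightarrow> act (LT True) (act (LA True) (act (LA True) m)) = act (LA True) (act (LT True) m)"
  using mult_t_twice_a[of "fst m" "snd m"] by (cases m) (simp add: act.simps add.assoc del: mult_t.simps)

lemma act_s_t: "m \<in> elements \<Longrightarrow> act (LS True) (act (LT True) m) = act (LA True) (act (LS True) m)"
  using mult_s_mult_t by (simp add: act.simps)

lemma act_s_a_s':
  assumes "m \<in> elements"
  shows "act (LS False) (act (LA True) (act (LS True) m)) = act (LT True) m"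
    and "act (LS False) (act (LA False) (act (LS True) m)) = act (LT False) m"
proof -
  have *: "act (LS False) (act (LA True) (act (LS True) m)) = act (LT True) m" if "m \<in> elements" for m
    using act_s_t[OF that] act_inv_act[OF act_valid[OF that, of "LT True"], of "LS True"]
    by simp
  from * assms show "act (LS False) (act (LA True) (act (LS True) m)) = act (LT True) m" .
  \<comment> \<open>The candidate for \<open>m t^-1\<close>; the chain below shows that multiplying
    it by \<open>t\<close> gives \<open>m\<close>.\<close>
  define n where "n = act (LS False) (act (LA False) (act (LS True) m))"
  have n: "n \<in> elements" using assms by (simp only: n_def act_valid)
  have "act (LT True) n = act (LS False) (act (LA True) (act (LS True) n))"
    using *[OF n] by simp
  also have "act (LS True) n = act (LA False) (act (LS True) m)"
    using act_act_inv[OF act_valid[OF act_valid[OF assms]], of "LS True" "LA False" "LS True"]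
    by (simp only: n_def inv_letter.simps simp_thms)
  also have "act (LS False) (act (LA True) (act (LA False) (act (LS True) m))) = m"
    using act_act_inv[OF act_valid[OF assms], of "LA True" "LS True"] act_inv_act[OF assms, of "LS True"]
    by (simp only: inv_letter.simps simp_thms)
  finally have "act (LT False) m = n"
    using act_inv_act[OF n, of "LT True"] by (simp only: inv_letter.simps simp_thms)
  then show "act (LS False) (act (LA False) (act (LS True) m)) = act (LT False) m"
    by (simp only: n_def)
qed


section \<open>Extending and shortening normal forms\<close>

fun extendable :: "letter \<Rightarrow> base \<times> int \<Rightarrow> bool" where
  "extendable (LA c) (b, k) \<longleftrightarrow> (if c then 0 \<le> k else k \<le> 0)"
| "extendable y m \<longleftrightarrow> stable_ok y m"

fun push :: "letter \<Rightarrow> base \<times> int \<Rightarrow> base \<times> int" where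
  "push (LA c) m = act_a c m"
| "push y (b, k) = ((k, y) # b, 0)"

definition a_word :: "int \<Rightarrow> letter list" where
  "a_word k = replicate (nat \<bar>k\<bar>) (LA (0 \<le> k))"

fun base_word :: "base \<Rightarrow> letter list" where
  "base_word [] = []"
| "base_word ((k, y) # b) = base_word b @ a_word k @ [y]"

fun word :: "base \<times> int \<Rightarrow> letter list" where
  "word (b, k) = base_word b @ a_word k"

lemma a_word_0 [simp]: "a_word 0 = []"
  by (simp add: a_word_def)

lemma a_word_step:
  "0 \<le> k \<Longrightarrow> a_word (k + 1) = a_word k @ [LA True]"
  "k \<le> 0 \<Longrightarrow> a_word (k - 1) = a_word k @ [LA False]"
proof -
  show "a_word (k + 1) = a_word k @ [LA True]" if "0 \<le> k"
  proof -
    have "nat \<bar>k + 1\<bar> = Suc (nat \<bar>k\<bar>)" using that by simp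
    with that show ?thesis by (simp add: a_word_def replicate_append_same)
  qed
  show "a_word (k - 1) = a_word k @ [LA False]" if "k \<le> 0"
  proof -
    have "nat \<bar>k - 1\<bar> = Suc (nat \<bar>k\<bar>)" using that by simp
    with that show ?thesis by (cases "k = 0") (simp_all add: a_word_def replicate_append_same)
  qed
qed

lemma act_extendable: "extendable y m \<Longrightarrow> act y m = push y m"
proof (cases m)
  case (Pair b k)
  assume "extendable y m"
  then show ?thesis
  proof (cases y)
    case (LT c)
    with Pair \<open>extendable y m\<close> show ?thesis by (cases c) (auto simp: act.simps mult_t'_other)
  next
    case (LS c)
    with Pair \<open>extendable y m\<close> show ?thesis
      by (cases c) (auto simp: act.simps mult_s'_other mult_s_def coset_rep_trivial)
  qed (simp add: Pair act.simps)
qed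

lemma word_push: "extendable y m \<Longrightarrow> word (push y m) = word m @ [y]"
  by (cases y; cases m) (auto simp: a_word_step)

lemma word_eq_Nil_iff: "word m = [] \<longleftrightarrow> m = ([], 0)"
  by (cases m; cases "fst m" rule: valid.cases) (auto simp: a_word_def)

fun last_letter :: "base \<times> int \<Rightarrow> letter option" where
  "last_letter (b, k) = (if 0 < k then Some (LA True) else if k < 0 then Some (LA False) else top_letter b)"

text \<open>The source of prefix closure: undoing the last letter leaves a valid element to which
  this letter may be appended.\<close>

lemma ex_push:
  assumes "m \<in> elements" "last_letter m = Some y"
  shows "\<exists>n\<in>elements. extendable y n \<and> m = push y n"
proof (cases m)
  case (Pair b k)
  consider "k > 0" "y = LA True" | "k < 0" "y = LA False" | "k = 0" "top_letter b = Some y"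
    using assms Pair by (auto split: if_splits)
  then show ?thesis
  proof cases
    case 1
    then show ?thesis using assms Pair by (intro bexI[of _ "(b, k - 1)"]) auto
  next
    case 2
    then show ?thesis using assms Pair by (intro bexI[of _ "(b, k + 1)"]) auto
  next
    case 3
    then obtain k' b' where "b = (k', y) # b'" "valid b'" "stable_ok y (b', k')"
      using assms(1) Pair by (auto elim: valid_topE)
    then show ?thesis using 3 Pair by (intro bexI[of _ "(b', k')"]; cases y) auto
  qed
qed

lemma last_letter_word: "word m = u @ [y] \<Longrightarrow> last_letter m = Some y"
proof (cases m)
  case (Pair b k)
  assume w: "word m = u @ [y]"
  show ?thesis
  proof (cases "k = 0")
    case True
    with w Pair show ?thesis by (cases b rule: valid.cases) auto
  next
    case False
    then obtain n where "nat \<bar>k\<bar> = Suc n" by (metis not0_implies_Suc nat_0_iff abs_le_zero_iff)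
    with w Pair False have "y = LA (0 \<le> k)"
      by (auto simp: a_word_def replicate_append_same[symmetric] simp del: replicate_append_same)
    with False Pair show ?thesis by auto
  qed
qed

lemma word_snoc:
  assumes "m \<in> elements" "word m = u @ [y]"
  shows "word (act (inv_letter y) m) = u"
proof -
  obtain n where n: "n \<in> elements" "extendable y n" "m = push y n"
    using ex_push[OF assms(1) last_letter_word[OF assms(2)]] by blast
  then have "m = act y n" by (simp add: act_extendable)
  then show ?thesis using n assms(2) word_push[of y n] act_inv_act[of n y] by simp
qed

text \<open>If the word of \<open>act y m\<close> ends with \<open>y\<close>, then this element is
  also \<open>act y n\<close> for some \<open>n\<close> extendable by \<open>y\<close>; injectivity
  of \<open>act y\<close> yields \<open>n = m\<close>.\<close>

lemma word_act_iff:
  assumes "m \<in> elements"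
  shows "word (act y m) = word m @ [y] \<longleftrightarrow> extendable y m"
proof
  assume w: "word (act y m) = word m @ [y]"
  obtain n where n: "n \<in> elements" "extendable y n" "act y m = push y n"
    using ex_push[OF act_valid[OF assms] last_letter_word[OF w]] by blast
  then have "act y m = act y n" by (simp add: act_extendable)
  then have "act (inv_letter y) (act y m) = act (inv_letter y) (act y n)" by (rule arg_cong)
  then have "m = n" unfolding act_inv_act[OF assms] act_inv_act[OF n(1)] .
  with n show "extendable y m" by simp
next
  assume "extendable y m"
  then show "word (act y m) = word m @ [y]" by (simp add: act_extendable word_push)
qed

lemma word_backtrack_iff:
  assumes "m \<in> elements"
  shows "word m = word (act y m) @ [inv_letter y] \<longleftrightarrow> last_letter m = Some (inv_letter y)"
proof
  assume "word m = word (act y m) @ [inv_letter y]"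
  then show "last_letter m = Some (inv_letter y)" by (rule last_letter_word)
next
  assume "last_letter m = Some (inv_letter y)"
  then obtain n where n: "n \<in> elements" "extendable (inv_letter y) n" "m = push (inv_letter y) n"
    using ex_push[OF assms] by blast
  then have "m = act (inv_letter y) n" by (simp add: act_extendable)
  then show "word m = word (act y m) @ [inv_letter y]"
    using n act_act_inv[of n y] word_push[of "inv_letter y" n] by simp
qed


section \<open>The flow function\<close>

text \<open>Describes the tree edges by exponents alone: where only a \<open>top_letter\<close>
  condition of \<open>stable_ok\<close> fails, the edge leads back to the parent and still lies in
  the tree.\<close>

fun fixed_edge :: "letter \<Rightarrow> base \<times> int \<Rightarrow> bool" where
  "fixed_edge (LA c) m \<longleftrightarrow> True"
| "fixed_edge (LT True) (b, k) \<longleftrightarrow> k = 0 \<or> k = 1"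
| "fixed_edge (LT False) (b, k) \<longleftrightarrow> k = 0"
| "fixed_edge (LS True) m \<longleftrightarrow> t_exp m = 0"
| "fixed_edge (LS False) (b, k) \<longleftrightarrow> k = 0"

lemma fixed_edge_iff:
  assumes "m \<in> elements"
  shows "fixed_edge y m \<longleftrightarrow> extendable y m \<or> last_letter m = Some (inv_letter y)"
proof (cases m)
  case (Pair b k)
  with assms have b: "valid b" by simp
  show ?thesis
  proof (cases y)
    case (LA c)
    then show ?thesis by (cases c) (auto simp: Pair)
  next
    case (LT c)
    then show ?thesis by (cases c) (auto simp: Pair)
  next
    case (LS c)
    \<comment> \<open>If \<open>m\<close> ends with \<open>s^-1\<close>, its final segment is
      trivial, so the edge leading back along \<open>s\<close> has \<open>t_exp\<close> 0 as
      well.\<close>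
    have "level b = 0" if "top_letter b = Some (LS False)"
      using level_top(3)[OF b] that by simp
    with LS show ?thesis by (cases c) (auto simp: Pair)
  qed
qed

section \<open>Finite states and the signs of exponents\<close>

type_synonym flow_state = "int \<times> bool \<times> letter option \<times> bool"

text \<open>Clamping \<open>k\<close> keeps apart the cases \<open>k < 0\<close>,
  \<open>k = 0\<close>, \<open>k = 1\<close> and \<open>k \<ge> 2\<close>, which decide
  extendability and flow. Parity and the last two entries serve to recover the sign of
  \<open>t_exp\<close>.\<close>

fun flow_state :: "base \<times> int \<Rightarrow> flow_state" where
  "flow_state (b, k) = (max (- 1) (min 2 k), even k, top_letter b, is_t_power b)"

fun t_sign :: "flow_state \<Rightarrow> int" where
  "t_sign (c, e, y, p) =
     (if \<not> p then 1 else if c \<noteq> 0 then (if e then - 1 else 0)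
      else if y = Some (LT True) then 1 else if y = Some (LT False) then - 1 else 0)"

text \<open>A final segment of \<open>b\<close> that is not a power of \<open>t\<close> has positive
  exponent. After a power of \<open>t\<close>, a nonzero \<open>k\<close> gives a negative exponent
  exactly when it is even, and for \<open>k = 0\<close> the top letter shows the sign.\<close>

lemma t_sign:
  assumes "m \<in> elements"
  shows "t_sign (flow_state m) = sgn (t_exp m)"
proof (cases m)
  case (Pair b k)
  with assms have b: "valid b" by simp
  have c: "max (- 1) (min 2 k) = 0 \<longleftrightarrow> k = 0" by auto
  show ?thesis
  proof (cases "is_t_power b")
    case True
    show ?thesis
    proof (cases "k = 0")
      case True
      with \<open>is_t_power b\<close> show ?thesis using level_top[OF b] by (auto simp: Pair)
    next
      case False
      have "multiplicity 2 k > 0 \<longleftrightarrow> even k"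
        using False multiplicity_half[of k] multiplicity_odd[of k] by (cases "even k") auto
      then show ?thesis using False True c by (auto simp: Pair)
    qed
  next
    case False
    with valid_pure[OF b] show ?thesis by (simp add: Pair)
  qed
qed

text \<open>The only unbounded condition for extension is \<open>t_exp = 0\<close> in the case of
  \<open>s\<close>, and the state determines it through \<open>t_sign\<close>.\<close>

lemma flow_state_extendable:
  assumes "m \<in> elements" "n \<in> elements" "flow_state m = flow_state n" "extendable y m"
  shows "extendable y n \<and> flow_state (push y n) = flow_state (push y m)"
proof -
  obtain b k where m: "m = (b, k)" by (cases m)
  obtain d l where n: "n = (d, l)" by (cases n)
  from assms(3) have c: "max (- 1) (min 2 k) = max (- 1) (min 2 l)" and e: "even k = even l"
    and top_letter: "top_letter b = top_letter d" and is_t_power: "is_t_power b = is_t_power d"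
    by (simp_all add: m n)
  from c have c': "k = 0 \<longleftrightarrow> l = 0" "k = 1 \<longleftrightarrow> l = 1" "0 \<le> k \<longleftrightarrow> 0 \<le> l" "k \<le> 0 \<longleftrightarrow> l \<le> 0"
    by (auto simp: max_def min_def split: if_splits)
  have t: "t_exp m = 0 \<longleftrightarrow> t_exp n = 0"
    using t_sign[OF assms(1)] t_sign[OF assms(2)] assms(3) by (metis sgn_0_0)
  show ?thesis
  proof (cases y)
    case (LA x)
    with assms(4) have "max (- 1) (min 2 (if x then k + 1 else k - 1))
        = max (- 1) (min 2 (if x then l + 1 else l - 1))"
      using c by (auto simp: m max_def min_def split: if_splits)
    with LA assms(4) c' e top_letter is_t_power show ?thesis by (cases x) (auto simp: m n)
  next
    case (LT x)
    with assms(4) c' top_letter is_t_power show ?thesis by (cases x) (auto simp: m n)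
  next
    case (LS x)
    with assms(4) c' top_letter is_t_power t show ?thesis by (cases x) (auto simp: m n simp del: t_exp.simps)
  qed
qed

lemma finite_flow_state: "finite (flow_state ` elements)"
proof (rule finite_subset)
  let ?S = "{- 1..2 :: int} \<times> (UNIV :: bool set) \<times> insert None (Some ` (LA ` UNIV \<union> LT ` UNIV \<union> LS ` UNIV)) \<times> (UNIV :: bool set)"
  show "flow_state ` elements \<subseteq> ?S"
  proof
    fix q assume "q \<in> flow_state ` elements"
    then obtain b k where q: "q = flow_state (b, k)" by auto
    have "top_letter b \<in> insert None (Some ` (LA ` UNIV \<union> LT ` UNIV \<union> LS ` UNIV))"
      by (cases "top_letter b"; cases "the (top_letter b)") auto
    moreover have "max (- 1) (min 2 k) \<in> {- 1..2}" by auto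
    ultimately show "q \<in> ?S" unfolding q flow_state.simps by (intro SigmaI UNIV_I)
  qed
  show "finite ?S" by simp
qed

section \<open>Replacement words and their descent\<close>

fun flow :: "flow_state \<Rightarrow> letter \<Rightarrow> letter list" where
  "flow q (LA c) = [LA c]"
| "flow (c, q) (LT True) =
     (if c = 2 then [LA False, LA False, LT True, LA True]
      else if c = - 1 then [LA True, LA True, LT True, LA False] else [LT True])"
| "flow (c, q) (LT False) =
     (if 0 < c then [LA False, LT False, LA True, LA True]
      else if c < 0 then [LA True, LT False, LA False, LA False] else [LT False])"
| "flow q (LS True) =
     (if 0 < t_sign q then [LT False, LS True, LA True]
      else if t_sign q < 0 then [LT True, LS True, LA False] else [LS True])"
| "flow (c, q) (LS False) =
     (if 0 < c then [LA False, LS False, LT True]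
      else if c < 0 then [LA True, LS False, LT False] else [LS False])"

lemma flow_cases:
  assumes "m \<in> elements"
  obtains "fixed_edge y m" "flow (flow_state m) y = [y]"
  | "y = LT True" "snd m \<ge> 2" "flow (flow_state m) y = [LA False, LA False, LT True, LA True]"
  | "y = LT True" "snd m < 0" "flow (flow_state m) y = [LA True, LA True, LT True, LA False]"
  | "y = LT False" "snd m > 0" "flow (flow_state m) y = [LA False, LT False, LA True, LA True]"
  | "y = LT False" "snd m < 0" "flow (flow_state m) y = [LA True, LT False, LA False, LA False]"
  | "y = LS True" "t_exp m > 0" "flow (flow_state m) y = [LT False, LS True, LA True]"
  | "y = LS True" "t_exp m < 0" "flow (flow_state m) y = [LT True, LS True, LA False]"
  | "y = LS False" "snd m > 0" "flow (flow_state m) y = [LA False, LS False, LT True]"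
  | "y = LS False" "snd m < 0" "flow (flow_state m) y = [LA True, LS False, LT False]"
proof -
  obtain b k where m: "m = (b, k)" by (cases m)
  have c: "max (- 1) (min 2 k) = 2 \<longleftrightarrow> k \<ge> 2" "max (- 1) (min 2 k) = - 1 \<longleftrightarrow> k < 0"
      "0 < max (- 1) (min 2 k) \<longleftrightarrow> k > 0" "max (- 1) (min 2 k) < 0 \<longleftrightarrow> k < 0"
    by (auto simp: max_def min_def)
  show thesis
  proof (cases y)
    case (LA x)
    then show thesis using that(1) by simp
  next
    case (LT x)
    consider "k \<ge> 2" | "k = 1" | "k = 0" | "k < 0" by linarith
    then show thesis using LT that(1-5) c by cases (cases x; force simp: m)+
  next
    case (LS x)
    show thesis
    proof (cases x)
      case True
      consider "t_exp m > 0" | "t_exp m = 0" | "t_exp m < 0" by linarith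
      then show thesis using LS True that(1,6,7) t_sign[OF assms] by cases auto
    next
      case False
      consider "k > 0" | "k = 0" | "k < 0" by linarith
      then show thesis using LS False that(1,8,9) c by cases (force simp: m)+
    qed
  qed
qed

lemma flow_fixed_edge:
  assumes "m \<in> elements" "fixed_edge y m"
  shows "flow (flow_state m) y = [y]"
proof -
  obtain b k where m: "m = (b, k)" by (cases m)
  from assms show ?thesis
    by (cases rule: flow_cases[where y = y]) (auto simp: m simp del: t_exp.simps flow_state.simps)
qed

lemma mult_t'_act_a: "act (LT False) (act (LA True) m) = act (LA True) (act (LA True) (act (LT False) m))"
  by (cases m; cases m rule: mult_t'.cases) (auto simp: act.simps mult_t'_other)

lemma mult_s'_act_a:
  assumes "m \<in> elements"
  shows "act (LS False) (act (LA True) m) = act (LT True) (act (LS False) m)"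
proof (cases m)
  case (Pair b k)
  show ?thesis
  proof (cases "top_letter b = Some (LS True)")
    case True
    with assms Pair obtain k' b' where "b = (k', LS True) # b'" "valid b'"
      by (auto elim: valid_topE)
    then show ?thesis using pow_t_Suc[of "(b', k')" k] by (simp add: Pair act.simps)
  next
    case False
    then show ?thesis
      using pow_t_Suc[of "((0, LS False) # b, 0)" k] assms by (simp add: Pair act.simps mult_s'_other)
  qed
qed

text \<open>Each replacement is a rearrangement of \<open>a a t = t a\<close>,
  \<open>t s = s a\<close> or one of their forms with inverse letters, all of which hold for the
  action.\<close>

lemma act_flow:
  assumes m: "m \<in> elements"
  shows "foldl (\<lambda>n z. act z n) m (flow (flow_state m) y) = act y m"
proof -
  note inv = act_act_inv[of _ "LA True"] act_act_inv[of _ "LA False"] act_act_inv[of _ "LT True"]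
    act_act_inv[of _ "LT False"]
  from m show ?thesis
  proof (cases rule: flow_cases[where y = y])
    case 2
    have "act (LA True) (act (LT True) (act (LA False) (act (LA False) m))) = act (LT True) m"
      using act_t_twice_a[OF act_valid[OF act_valid[OF m]], of "LA False" "LA False"]
        inv(1)[OF act_valid[OF m], of "LA False"] inv(1)[OF m] by simp
    with 2 show ?thesis by simp
  next
    case 3
    have "act (LA False) (act (LT True) (act (LA True) (act (LA True) m))) = act (LT True) m"
      using act_t_twice_a[OF m] inv(2)[OF act_valid[OF m], of "LT True"] by simp
    with 3 show ?thesis by simp
  next
    case 4
    have "act (LA True) (act (LA True) (act (LT False) (act (LA False) m))) = act (LT False) m"
      using mult_t'_act_a[of "act (LA False) m"] inv(1)[OF m] by simp
    with 4 show ?thesis by simp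
  next
    case 5
    have "act (LA False) (act (LA False) (act (LT False) (act (LA True) m))) = act (LT False) m"
      using mult_t'_act_a[of m] inv(2)[OF act_valid[OF act_valid[OF m]], of "LA True" "LT False"]
        inv(2)[OF act_valid[OF m], of "LT False"]
      by simp
    with 5 show ?thesis by simp
  next
    case 6
    have "act (LA True) (act (LS True) (act (LT False) m)) = act (LS True) m"
      using act_s_t[OF act_valid[OF m], of "LT False"] inv(3)[OF m] by simp
    with 6 show ?thesis by simp
  next
    case 7
    have "act (LA False) (act (LS True) (act (LT True) m)) = act (LS True) m"
      using act_s_t[OF m] inv(2)[OF act_valid[OF m], of "LS True"] by simp
    with 7 show ?thesis by simp
  next
    case 8
    have "act (LT True) (act (LS False) (act (LA False) m)) = act (LS False) m"
      using mult_s'_act_a[OF act_valid[OF m], of "LA False"] inv(1)[OF m] by simp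
    with 8 show ?thesis by simp
  next
    case 9
    have "act (LT False) (act (LS False) (act (LA True) m)) = act (LS False) m"
      using mult_s'_act_a[OF m] inv(4)[OF act_valid[OF m], of "LS False"] by simp
    with 9 show ?thesis by simp
  qed simp
qed

lemma t_exp_mult_t':
  assumes "m \<in> elements"
  shows "t_exp (mult_t' m) = t_exp m - 1"
  using t_exp_mult_t[OF mult_t'_valid[OF assms]] mult_t_mult_t'[OF assms] by simp

fun flow_measure :: "letter \<Rightarrow> base \<times> int \<Rightarrow> nat \<times> nat" where
  "flow_measure (LA c) m = (0, 0)"
| "flow_measure (LT c) m = (0, nat \<bar>snd m\<bar>)"
| "flow_measure (LS True) m = (1, nat \<bar>t_exp m\<bar>)"
| "flow_measure (LS False) m = (1, nat \<bar>snd m\<bar>)"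

primrec action_path :: "base \<times> int \<Rightarrow> letter list \<Rightarrow> ((base \<times> int) \<times> letter) list" where
  "action_path m [] = []"
| "action_path m (y # w) = (m, y) # action_path (act y m) w"

text \<open>The copy of \<open>y\<close> in its replacement starts at an exponent closer to 0,
  except for \<open>t\<close> at exponent -1, where the copy starts at exponent 1 and is fixed. The
  \<open>t\<close> edges replacing an \<open>s\<close> edge are smaller by the first component of
  the measure, and \<open>a\<close> edges are always fixed.\<close>

lemma flow_measure_less:
  assumes "m \<in> elements" "\<not> fixed_edge y m"
    "(n, z) \<in> set (action_path m (flow (flow_state m) y))" "\<not> fixed_edge z n"
  shows "(flow_measure z n, flow_measure y m) \<in> less_than <*lex*> less_than"
proof -
  obtain b k where m: "m = (b, k)" by (cases m)
  note t = t_exp_mult_t[OF assms(1)] t_exp_mult_t'[OF assms(1)]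
  from assms(1) show ?thesis
  proof (cases rule: flow_cases[where y = y])
    case 1
    then show ?thesis using assms(2) by simp
  next
    case 6
    then show ?thesis using assms(3,4) t(2) by (auto simp: act.simps simp del: t_exp.simps)
  next
    case 7
    then show ?thesis using assms(3,4) t(1) by (auto simp: act.simps simp del: t_exp.simps mult_t.simps)
  qed (use assms(3,4) m in \<open>auto simp: act.simps simp del: t_exp.simps mult_t.simps\<close>)
qed


section \<open>The Baumslag--Gersten group acts on its normal forms\<close>

interpretation BG: group baumslag_gersten_group
  unfolding baumslag_gersten_group_def by (rule group_presented_group)

abbreviation (input) BG :: "(baumslag_generator \<times> bool) list set monoid" where
  "BG \<equiv> baumslag_gersten_group"

section \<open>Letters as elements of the group\<close>

definition word_class :: "(baumslag_generator \<times> bool) list \<Rightarrow> (baumslag_generator \<times> bool) list set" where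
  "word_class w = presentation_congruence baumslag_relations `` {w}"

lemma word_class_mult: "word_class u \<otimes>\<^bsub>BG\<^esub> word_class v = word_class (u @ v)"
  by (simp add: word_class_def baumslag_gersten_group_def presented_group_mult)

lemma carrier_BG: "carrier BG = range word_class"
  by (auto simp: word_class_def baumslag_gersten_group_def presented_group_def quotient_def)

lemma one_BG: "\<one>\<^bsub>BG\<^esub> = word_class []"
  by (simp add: word_class_def baumslag_gersten_group_def presented_group_def)

lemma word_class_closed [simp]: "word_class w \<in> carrier BG"
  by (simp add: carrier_BG)

lemma word_class_eqI: "(u, v) \<in> presentation_congruence baumslag_relations \<Longrightarrow> word_class u = word_class v"
  unfolding word_class_def by (rule equiv_class_eq[OF equiv_presentation_congruence])

lemma word_class_cancel: "word_class (u @ (x, b) # (x, \<not> b) # v) = word_class (u @ v)"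
  using cong_cancel[of u x b v baumslag_relations] by (intro word_class_eqI) simp

primrec letter_word :: "letter \<Rightarrow> (baumslag_generator \<times> bool) list" where
  "letter_word (LA c) = [(Gen_a, c)]"
| "letter_word (LT c) = [(Gen_s, True), (Gen_a, c), (Gen_s, False)]"
| "letter_word (LS c) = [(Gen_s, c)]"

definition ev :: "letter \<Rightarrow> (baumslag_generator \<times> bool) list set" where
  "ev y = word_class (letter_word y)"

lemma ev_closed [simp]: "ev y \<in> carrier BG"
  by (simp add: ev_def)

lemma inv_ev [simp]: "inv\<^bsub>BG\<^esub> (ev y) = ev (inv_letter y)"
proof (rule BG.inv_equality)
  show "ev (inv_letter y) \<otimes>\<^bsub>BG\<^esub> ev y = \<one>\<^bsub>BG\<^esub>"
  proof (cases y)
    case (LA c)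
    then show ?thesis
      using word_class_cancel[of "[]" Gen_a "\<not> c" "[]"] by (simp add: ev_def word_class_mult one_BG)
  next
    case (LT c)
    then show ?thesis
      using word_class_cancel[of "[(Gen_s, True), (Gen_a, \<not> c)]" Gen_s False "[(Gen_a, c), (Gen_s, False)]"]
        word_class_cancel[of "[(Gen_s, True)]" Gen_a "\<not> c" "[(Gen_s, False)]"]
        word_class_cancel[of "[]" Gen_s True "[]"]
      by (simp add: ev_def word_class_mult one_BG)
  next
    case (LS c)
    then show ?thesis
      using word_class_cancel[of "[]" Gen_s "\<not> c" "[]"] by (simp add: ev_def word_class_mult one_BG)
  qed
qed simp_all

lemma ev_t_a: "ev (LT True) \<otimes>\<^bsub>BG\<^esub> ev (LA True) = ev (LA True) \<otimes>\<^bsub>BG\<^esub> ev (LA True) \<otimes>\<^bsub>BG\<^esub> ev (LT True)"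
proof -
  \<comment> \<open>With \<open>t\<close> written for \<open>s a s^-1\<close>, the defining relation
    is \<open>t a t^-1 = a^2\<close>.\<close>
  have "ev (LT True) \<otimes>\<^bsub>BG\<^esub> ev (LA True) \<otimes>\<^bsub>BG\<^esub> ev (LT False) = ev (LA True) \<otimes>\<^bsub>BG\<^esub> ev (LA True)"
    using cong_relation[of "[(Gen_s, True), (Gen_a, True), (Gen_s, False), (Gen_a, True), (Gen_s, True),
        (Gen_a, False), (Gen_s, False)]" "[(Gen_a, True), (Gen_a, True)]" baumslag_relations "[]" "[]"]
    unfolding ev_def word_class_mult
    by (intro word_class_eqI) (simp add: baumslag_relations_def Let_def)
  then have "ev (LT True) \<otimes>\<^bsub>BG\<^esub> ev (LA True) \<otimes>\<^bsub>BG\<^esub> ev (LT False) \<otimes>\<^bsub>BG\<^esub> ev (LT True)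
      = ev (LA True) \<otimes>\<^bsub>BG\<^esub> ev (LA True) \<otimes>\<^bsub>BG\<^esub> ev (LT True)"
    by simp
  moreover have "ev (LT False) \<otimes>\<^bsub>BG\<^esub> ev (LT True) = \<one>\<^bsub>BG\<^esub>"
    using BG.l_inv[of "ev (LT True)"] by simp
  ultimately show ?thesis by (simp add: BG.m_assoc)
qed

lemma ev_s_a: "ev (LS True) \<otimes>\<^bsub>BG\<^esub> ev (LA True) = ev (LT True) \<otimes>\<^bsub>BG\<^esub> ev (LS True)"
  using word_class_cancel[of "[(Gen_s, True), (Gen_a, True)]" Gen_s False "[]"]
  by (simp add: ev_def word_class_mult)

text \<open>Both \<open>t a = a^2 t\<close> and \<open>s a = t s\<close> have the form
  \<open>y x = u y\<close>, and the conclusions about \<open>g\<close> are the replacements of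
  \<open>y\<close>. The last conclusion has this form again, now for the inverse of
  \<open>y\<close>, so the lemma also yields the replacements of \<open>t^-1\<close> and
  \<open>s^-1\<close>.\<close>

lemma (in group) mult_conjugate:
  assumes "y \<otimes> x = u \<otimes> y" and [simp]: "g \<in> carrier G" "x \<in> carrier G" "y \<in> carrier G" "u \<in> carrier G"
  shows "g \<otimes> inv u \<otimes> y \<otimes> x = g \<otimes> y" "g \<otimes> u \<otimes> y \<otimes> inv x = g \<otimes> y"
    and "inv y \<otimes> u = x \<otimes> inv y"
proof -
  show "g \<otimes> inv u \<otimes> y \<otimes> x = g \<otimes> y"
    by (simp add: m_assoc assms(1)) (simp flip: m_assoc)
  have "g \<otimes> u \<otimes> y \<otimes> inv x = g \<otimes> (u \<otimes> y) \<otimes> inv x" by (simp add: m_assoc)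
  also have "\<dots> = g \<otimes> y" by (simp add: m_assoc flip: assms(1))
  finally show "g \<otimes> u \<otimes> y \<otimes> inv x = g \<otimes> y" .
  have "inv y \<otimes> u = inv y \<otimes> (u \<otimes> y) \<otimes> inv y" by (simp add: m_assoc)
  also have "\<dots> = x \<otimes> inv y" by (simp flip: assms(1) add: m_assoc[symmetric])
  finally show "inv y \<otimes> u = x \<otimes> inv y" .
qed

lemma ev_flow:
  assumes "g \<in> carrier BG"
  shows "foldl (\<otimes>\<^bsub>BG\<^esub>) g (map ev (flow q y)) = g \<otimes>\<^bsub>BG\<^esub> ev y"
proof -
  let ?A = "ev (LA True)"
  have inv2: "inv\<^bsub>BG\<^esub> (?A \<otimes>\<^bsub>BG\<^esub> ?A) = ev (LA False) \<otimes>\<^bsub>BG\<^esub> ev (LA False)"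
    by (simp add: BG.inv_mult_group)
  note t = BG.mult_conjugate[OF ev_t_a assms, simplified inv2, simplified]
  note s = BG.mult_conjugate[OF ev_s_a assms, simplified]
  note t' = BG.mult_conjugate(1,2)[OF t(3) assms, simplified inv2, simplified]
  note s' = BG.mult_conjugate(1,2)[OF s(3) assms, simplified]
  show ?thesis
    using t t' s s' assms
    by (cases "(q, y)" rule: flow.cases) (auto simp: BG.m_assoc)
qed

section \<open>The action of the group on normal forms\<close>

fun generator_act :: "baumslag_generator \<times> bool \<Rightarrow> base \<times> int \<Rightarrow> base \<times> int" where
  "generator_act (Gen_a, c) = act (LA c)"
| "generator_act (Gen_s, c) = act (LS c)"

definition run :: "base \<times> int \<Rightarrow> (baumslag_generator \<times> bool) list \<Rightarrow> base \<times> int" where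
  "run = foldl (\<lambda>m z. generator_act z m)"

lemma run_simps [simp]:
  "run m [] = m" "run m (z # w) = run (generator_act z m) w" "run m (u @ w) = run (run m u) w"
  by (simp_all add: run_def)

lemma generator_act_valid: "m \<in> elements \<Longrightarrow> generator_act z m \<in> elements"
  by (cases z rule: generator_act.cases) (simp_all only: generator_act.simps act_valid)

lemma run_valid: "m \<in> elements \<Longrightarrow> run m w \<in> elements"
proof (induction w arbitrary: m)
  case (Cons z w)
  then show ?case using generator_act_valid[OF Cons.prems] by (simp only: run_simps)
qed (simp only: run_simps)

lemma run_letter_word: "m \<in> elements \<Longrightarrow> run m (letter_word y) = act y m"
proof (cases y)
  case (LT c)
  assume "m \<in> elements"
  with LT show ?thesis using act_s_a_s'[of m] by (cases c) simp_all
qed simp_all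

text \<open>Free cancellations act trivially, and the sides of the relation spell
  \<open>t a t^-1\<close> and \<open>a a\<close>, which act alike. Hence the action of words
  descends to the group.\<close>

lemma run_cong:
  assumes "(u, v) \<in> presentation_congruence baumslag_relations" "m \<in> elements"
  shows "run m u = run m v"
  using assms
proof (induction arbitrary: m rule: presentation_congruence.induct)
  case (cong_cancel u x b v)
  have "generator_act (x, \<not> b) (generator_act (x, b) n) = n" if "n \<in> elements" for n
    using act_inv_act[OF that, of "LA b"] act_inv_act[OF that, of "LS b"] by (cases x) auto
  with run_valid[OF cong_cancel.prems, of u] show ?case by simp
next
  case (cong_relation l r u v)
  have l: "l = letter_word (LT True) @ letter_word (LA True) @ letter_word (LT False)"
    and r: "r = letter_word (LA True) @ letter_word (LA True)"
    using cong_relation by (simp_all add: baumslag_relations_def Let_def)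
  have "run n l = run n r" if n: "n \<in> elements" for n
  proof -
    note v = act_valid[OF n] act_valid[OF act_valid[OF n]]
    have "run n l = act (LT False) (act (LA True) (act (LT True) n))"
      unfolding l run_simps(3) run_letter_word[OF n] run_letter_word[OF v(1)] run_letter_word[OF v(2)] ..
    also have "\<dots> = act (LA True) (act (LA True) n)"
      using act_t_twice_a[OF n, symmetric] act_inv_act[OF v(2), of "LT True"] by simp
    also have "\<dots> = run n r"
      unfolding r run_simps(3) run_letter_word[OF n] run_letter_word[OF v(1)] ..
    finally show ?thesis .
  qed
  with run_valid[OF cong_relation.prems, of u] show ?case by simp
qed auto

text \<open>The image of the empty normal form under \<open>g\<close>; by \<open>run_cong\<close>,
  the choice of a representing word is immaterial.\<close>

definition element :: "(baumslag_generator \<times> bool) list set \<Rightarrow> base \<times> int" where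
  "element g = run ([], 0) (SOME w. w \<in> g)"

lemma element_word_class: "element (word_class w) = run ([], 0) w"
proof -
  have "w \<in> word_class w" by (simp add: word_class_def cong_refl)
  then have "(SOME v. v \<in> word_class w) \<in> word_class w" by (rule someI)
  then have "run ([], 0) w = run ([], 0) (SOME v. v \<in> word_class w)"
    by (intro run_cong) (simp_all add: word_class_def)
  then show ?thesis by (simp add: element_def)
qed

lemma element_valid: "g \<in> carrier BG \<Longrightarrow> element g \<in> elements"
  using run_valid[of "([], 0)"] by (auto simp: carrier_BG element_word_class)

lemma element_one: "element \<one>\<^bsub>BG\<^esub> = ([], 0)"
  by (simp add: one_BG element_word_class)

lemma element_mult:
  assumes "g \<in> carrier BG"
  shows "element (g \<otimes>\<^bsub>BG\<^esub> ev y) = act y (element g)"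
proof -
  obtain w where w: "g = word_class w" using assms by (auto simp: carrier_BG)
  show ?thesis
    using run_letter_word[OF run_valid, of "([], 0)" w y]
    by (simp add: w ev_def word_class_mult element_word_class)
qed

section \<open>Evaluation of normal forms\<close>

definition eval :: "base \<times> int \<Rightarrow> (baumslag_generator \<times> bool) list set" where
  "eval m = foldl (\<otimes>\<^bsub>BG\<^esub>) \<one>\<^bsub>BG\<^esub> (map ev (word m))"

lemma foldl_ev_closed: "g \<in> carrier BG \<Longrightarrow> foldl (\<otimes>\<^bsub>BG\<^esub>) g (map ev w) \<in> carrier BG"
  by (induction w arbitrary: g) auto

lemma eval_closed [simp]: "eval m \<in> carrier BG"
  by (simp add: eval_def foldl_ev_closed)

lemma eval_act_fixed:
  assumes "m \<in> elements" "fixed_edge y m"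
  shows "eval (act y m) = eval m \<otimes>\<^bsub>BG\<^esub> ev y"
proof -
  consider "extendable y m" | "last_letter m = Some (inv_letter y)"
    using assms fixed_edge_iff by blast
  then show ?thesis
  proof cases
    case 1
    then have "word (act y m) = word m @ [y]" using word_act_iff[OF assms(1)] by blast
    then show ?thesis by (simp add: eval_def)
  next
    case 2
    then have "word m = word (act y m) @ [inv_letter y]" using word_backtrack_iff[OF assms(1)] by blast
    then have "eval m = eval (act y m) \<otimes>\<^bsub>BG\<^esub> ev (inv_letter y)" by (simp add: eval_def)
    moreover have "ev (inv_letter y) \<otimes>\<^bsub>BG\<^esub> ev y = \<one>\<^bsub>BG\<^esub>"
      using BG.l_inv[of "ev y"] by simp
    ultimately show ?thesis by (simp add: BG.m_assoc)
  qed
qed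

lemma eval_path:
  assumes "\<And>n z. (n, z) \<in> set (action_path m w) \<Longrightarrow> eval (act z n) = eval n \<otimes>\<^bsub>BG\<^esub> ev z"
  shows "eval (foldl (\<lambda>n z. act z n) m w) = foldl (\<otimes>\<^bsub>BG\<^esub>) (eval m) (map ev w)"
  using assms by (induction w arbitrary: m) auto

lemma action_path_valid: "m \<in> elements \<Longrightarrow> (n, z) \<in> set (action_path m w) \<Longrightarrow> n \<in> elements"
proof (induction w arbitrary: m)
  case (Cons y w)
  then consider "n = m" | "(n, z) \<in> set (action_path (act y m) w)" by auto
  then show ?case
    using Cons.IH[OF act_valid[OF Cons.prems(1)]] Cons.prems(1) by cases blast+
qed simp

text \<open>Outside the tree, the flow reduces the claim to smaller edges.\<close>

lemma eval_act:
  assumes "m \<in> elements"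
  shows "eval (act y m) = eval m \<otimes>\<^bsub>BG\<^esub> ev y"
  using assms
proof (induction "flow_measure y m" arbitrary: y m rule: wf_induct_rule[OF wf_lex_prod[OF wf_less_than wf_less_than]])
  case 1
  show ?case
  proof (cases "fixed_edge y m")
    case True
    with 1(2) show ?thesis by (rule eval_act_fixed)
  next
    case False
    let ?w = "flow (flow_state m) y"
    have "eval (act z n) = eval n \<otimes>\<^bsub>BG\<^esub> ev z" if "(n, z) \<in> set (action_path m ?w)" for n z
    proof (cases "fixed_edge z n")
      case True
      then show ?thesis using eval_act_fixed action_path_valid[OF 1(2) that] by blast
    next
      case nf: False
      show ?thesis
        using 1(1)[OF flow_measure_less[OF 1(2) False that nf] action_path_valid[OF 1(2) that]] .
    qed
    then have "eval (foldl (\<lambda>n z. act z n) m ?w) = foldl (\<otimes>\<^bsub>BG\<^esub>) (eval m) (map ev ?w)"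
      by (rule eval_path)
    \<comment> \<open>The replacement word has the effect of \<open>y\<close> both on normal forms
      and in the group.\<close>
    then show ?thesis by (simp only: act_flow[OF 1(2)] ev_flow eval_closed)
  qed
qed

text \<open>As \<open>eval\<close> turns the action into right multiplication, the normal form
  reached by a word evaluates to the class of that word. So distinct group elements have distinct
  normal forms.\<close>

lemma eval_element:
  assumes "g \<in> carrier BG"
  shows "eval (element g) = g"
proof -
  obtain w where w: "g = word_class w" using assms by (auto simp: carrier_BG)
  have "eval (run ([], 0) w) = word_class w"
  proof (induction w rule: rev_induct)
    case Nil
    show ?case by (simp add: eval_def one_BG)
  next
    case (snoc z w)
    obtain y where y: "generator_act z = act y" "letter_word y = [z]"
      by (cases z rule: generator_act.cases) (metis generator_act.simps letter_word.simps)+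
    have "eval (run ([], 0) (w @ [z])) = word_class w \<otimes>\<^bsub>BG\<^esub> ev y"
      using eval_act[OF run_valid[of "([], 0)" w], of y] snoc by (simp add: y)
    then show ?case by (simp add: ev_def y word_class_mult)
  qed
  then show ?thesis by (simp add: w element_word_class)
qed

text \<open>Every letter may follow the empty normal form, so different letters send it to different
  normal forms.\<close>

lemma inj_ev: "inj ev"
proof (rule injI)
  fix y z assume "ev y = ev z"
  then have "act y ([], 0) = act z ([], 0)"
    using element_mult[OF BG.one_closed] by (metis element_one)
  moreover have "extendable x ([], 0)" for x
    by (cases x; cases "\<exists>c. c \<and> x = LT c \<or> c \<and> x = LS c") auto
  ultimately have "push y ([], 0) = push z ([], 0)"
    by (simp add: act_extendable)
  then show "y = z" by (cases y; cases z) (auto split: if_splits)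
qed

abbreviation "letter_of \<equiv> the_inv ev"

lemma letter_of_ev [simp]: "letter_of (ev y) = y"
  by (rule the_inv_f_f[OF inj_ev])

lemma map_ev_eq_snoc_iff: "map ev u = map ev v @ [ev y] \<longleftrightarrow> u = v @ [y]"
  using inj_map_eq_map[OF inj_ev, of u "v @ [y]"] by simp

section \<open>Verification of the criterion\<close>

definition bg_nf :: "(baumslag_generator \<times> bool) list set \<Rightarrow> (baumslag_generator \<times> bool) list set list" where
  "bg_nf g = map ev (word (element g))"

interpretation BG: prefix_closed_normal_forms baumslag_gersten_group "range ev" bg_nf
proof
  show "range ev \<subseteq> carrier BG" by auto
  show "\<one>\<^bsub>BG\<^esub> \<notin> range ev"
  proof
    assume "\<one>\<^bsub>BG\<^esub> \<in> range ev"
    then obtain y where "\<one>\<^bsub>BG\<^esub> = ev y" by blast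
    then have "\<one>\<^bsub>BG\<^esub> \<otimes>\<^bsub>BG\<^esub> ev y \<otimes>\<^bsub>BG\<^esub> ev y = \<one>\<^bsub>BG\<^esub> \<otimes>\<^bsub>BG\<^esub> ev y" by simp
    \<comment> \<open>The identity is its own inverse, whereas no letter is its own inverse letter
      and \<open>ev\<close> is injective.\<close>
    then have "ev y = ev (inv_letter y)" by (metis BG.inv_one \<open>\<one>\<^bsub>BG\<^esub> = ev y\<close> inv_ev)
    then show False using inj_ev by (cases y) (auto dest: injD)
  qed
  show "inv\<^bsub>BG\<^esub> x \<in> range ev" if "x \<in> range ev" for x
    using that by auto
  fix g assume g: "g \<in> carrier BG"
  show "bg_nf g \<in> lists (range ev)" by (auto simp: bg_nf_def)
  show "bg_nf g = [] \<longleftrightarrow> g = \<one>\<^bsub>BG\<^esub>"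
    using eval_element[OF g] eval_element[OF BG.one_closed] element_one
    by (auto simp: bg_nf_def word_eq_Nil_iff)
  fix w x assume w: "bg_nf g = w @ [x]"
  then obtain u y where u: "word (element g) = u @ [y]" "w = map ev u" "x = ev y"
    by (auto simp: bg_nf_def map_eq_append_conv)
  show "bg_nf (g \<otimes>\<^bsub>BG\<^esub> inv\<^bsub>BG\<^esub> x) = w"
    using word_snoc[OF element_valid[OF g] u(1)] g by (simp add: bg_nf_def u element_mult)
qed

lemma bg_nf_snoc_iff:
  assumes "g \<in> carrier BG"
  shows "bg_nf (g \<otimes>\<^bsub>BG\<^esub> ev y) = bg_nf g @ [ev y] \<longleftrightarrow> extendable y (element g)"
  unfolding bg_nf_def element_mult[OF assms] map_ev_eq_snoc_iff
  by (rule word_act_iff[OF element_valid[OF assms]])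

lemma tree_edge_iff:
  assumes "g \<in> carrier BG"
  shows "BG.tree_edge g (ev y) \<longleftrightarrow> fixed_edge y (element g)"
  unfolding BG.tree_edge_def inv_ev bg_nf_def element_mult[OF assms] map_ev_eq_snoc_iff
    word_act_iff[OF element_valid[OF assms]] word_backtrack_iff[OF element_valid[OF assms]]
    fixed_edge_iff[OF element_valid[OF assms]] ..

text \<open>Carries paths in the Cayley graph over to normal forms, where
  \<open>flow_measure_less\<close> applies.\<close>

lemma edge_path_action_path:
  assumes "g \<in> carrier BG" "(h, x) \<in> set (edge_path BG g (map ev w))"
  shows "h \<in> carrier BG \<and> (\<exists>z. x = ev z \<and> (element h, z) \<in> set (action_path (element g) w))"
  using assms
proof (induction w arbitrary: g)
  case (Cons y w)
  then consider "h = g" "x = ev y" | "(h, x) \<in> set (edge_path BG (g \<otimes>\<^bsub>BG\<^esub> ev y) (map ev w))" by auto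
  then show ?case
  proof cases
    case 1
    with Cons.prems(1) show ?thesis by auto
  next
    case 2
    with Cons.IH[of "g \<otimes>\<^bsub>BG\<^esub> ev y"] Cons.prems(1) show ?thesis by (auto simp: element_mult)
  qed
qed simp

definition bg_flow_word :: "flow_state \<Rightarrow> (baumslag_generator \<times> bool) list set
    \<Rightarrow> (baumslag_generator \<times> bool) list set list" where
  "bg_flow_word q x = map ev (flow q (letter_of x))"

definition bg_flow_order where
  "bg_flow_order = inv_image (less_than <*lex*> less_than) (\<lambda>(g, x). flow_measure (letter_of x) (element g))"

interpretation BG: automatic_flow baumslag_gersten_group "range ev" bg_nf
  "\<lambda>g. flow_state (element g)" bg_flow_word bg_flow_order
proof
  have "UNIV = LA ` UNIV \<union> LT ` UNIV \<union> LS ` UNIV"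
  proof (rule Set.set_eqI)
    show "y \<in> UNIV \<longleftrightarrow> y \<in> LA ` UNIV \<union> LT ` UNIV \<union> LS ` UNIV" for y by (cases y) auto
  qed
  then show "finite (range ev)" by (metis finite_UnI finite_imageI finite)
  show "finite ((\<lambda>g. flow_state (element g)) ` carrier BG)"
    by (rule finite_subset[OF _ finite_flow_state]) (use element_valid in blast)
  show "wf bg_flow_order"
    unfolding bg_flow_order_def by (intro wf_inv_image wf_lex_prod wf_less_than)
  fix g x assume g: "g \<in> carrier BG" and "x \<in> range ev"
  then obtain y where x: "x = ev y" by blast
  show "bg_flow_word (flow_state (element g)) x \<in> lists (range ev)"
    by (auto simp: bg_flow_word_def)
  show "foldl (\<otimes>\<^bsub>BG\<^esub>) g (bg_flow_word (flow_state (element g)) x) = g \<otimes>\<^bsub>BG\<^esub> x"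
    by (simp add: bg_flow_word_def x ev_flow[OF g])
  show "bg_flow_word (flow_state (element g)) x = [x]" if "BG.tree_edge g x"
  proof -
    have fixed: "fixed_edge y (element g)" using that tree_edge_iff[OF g] by (simp add: x)
    then show ?thesis using flow_fixed_edge[OF element_valid[OF g]] by (simp add: bg_flow_word_def x)
  qed
  show "((h, z), (g, x)) \<in> bg_flow_order"
    if "\<not> BG.tree_edge g x" "(h, z) \<in> set (edge_path BG g (bg_flow_word (flow_state (element g)) x))"
      "\<not> BG.tree_edge h z" for h z
  proof -
    from edge_path_action_path[OF g] that(2) obtain v where h: "h \<in> carrier BG" and v: "z = ev v"
        "(element h, v) \<in> set (action_path (element g) (flow (flow_state (element g)) y))"
      unfolding bg_flow_word_def x letter_of_ev by blast
    then show ?thesis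
      using flow_measure_less[OF element_valid[OF g] _ v(2)] that tree_edge_iff[OF g] tree_edge_iff[OF h]
      by (simp add: bg_flow_order_def x)
  qed
  fix h assume h: "h \<in> carrier BG" and st: "flow_state (element g) = flow_state (element h)"
    and "bg_nf (g \<otimes>\<^bsub>BG\<^esub> x) = bg_nf g @ [x]"
  then have "extendable y (element g)" using bg_nf_snoc_iff[OF g] by (simp add: x)
  with flow_state_extendable[OF element_valid[OF g] element_valid[OF h] st]
  have "extendable y (element h)" "flow_state (push y (element h)) = flow_state (push y (element g))"
    by blast+
  with \<open>extendable y (element g)\<close>
  show "bg_nf (h \<otimes>\<^bsub>BG\<^esub> x) = bg_nf h @ [x] \<and> flow_state (element (h \<otimes>\<^bsub>BG\<^esub> x)) = flow_state (element (g \<otimes>\<^bsub>BG\<^esub> x))"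
    unfolding x bg_nf_snoc_iff[OF h] element_mult[OF g] element_mult[OF h] by (simp add: act_extendable)
qed

theorem theorem5p3:
  shows "autostackable baumslag_gersten_group"
  by (rule BG.autostackable)

end
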